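(* Let $\mathfrak{R}$ be a root system in $\mathbb{R}^d$ (normalized by $|\alpha|=\sqrt2$ for all $\alpha\in\mathfrak{R}$), let $\kappa:\mathfrak{R}\to[0,\infty)$ be invariant under the Weyl group $G$, and suppose that $G$ is isomorphic to $\mathbb{Z}_2^d$. Then for every $f\in C^4(\mathbb{R}^d)$, pointwise on $\mathbb{R}^d$, $$\Gamma_2(f)\ge\|\mathrm{Hess}(f)\|_{\mathrm{HS}}^2,$$ where $\mathrm{Hess}(f)$ is the Hessian of $f$ and $\|\cdot\|_{\mathrm{HS}}$ is the Hilbert--Schmidt norm.
   Context: Functions are real-valued. For $\alpha\in\mathbb{R}^d\setminus\{0\}$ let $r_\alpha x=x-2\frac{\langle\alpha,x\rangle}{|\alpha|^2}\alpha$. A root system $\mathfrak{R}$ is a finite nonempty subset of $\mathbb{R}^d\setminus\{0\}$ with $\mathfrak{R}\cap\alpha\mathbb{R}=\{\alpha,-\alpha\}$ and $r_\alpha(\mathfrak{R})=\mathfrak{R}$ for all $\alpha\in\mathfrak{R}$; it is normalized so that $|\alpha|=\sqrt2$ for all $\alpha\in\mathfrak{R}$. The Weyl group $G$ is the (finite) group generated by $\{r_\alpha:\alpha\in\mathfrak{R}\}$. Fix $y\in\mathbb{R}^d$ with $\langle\alpha,y\rangle\neq0$ for all $\alpha\in\mathfrak{R}$ and set $\mathfrak{R}_+=\{\alpha\in\mathfrak{R}:\langle\alpha,y\rangle>0\}$. $\kappa:\mathfrak{R}\to[0,\infty)$ is $G$-invariant: $\kappa_{g\alpha}=\kappa_\alpha$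 for $g\in G$, $\alpha\in\mathfrak{R}$. The Dunkl Laplacian is, for $f\in C^2(\mathbb{R}^d)$, $$\Delta_\kappa f(x)=\Delta f(x)+2\sum_{\alpha\in\mathfrak{R}_+}\kappa_\alpha\Big(\frac{\langle\alpha,\nabla f(x)\rangle}{\langle\alpha,x\rangle}-\frac{f(x)-f(r_\alpha x)}{\langle\alpha,x\rangle^2}\Big).$$ Expressions containing $\langle\alpha,x\rangle$ in a denominator are understood by continuous extension where $\langle\alpha,x\rangle=0$. The carré du champ operator is $\Gamma(f,g)=\frac12[\Delta_\kappa(fg)-f\Delta_\kappa g-g\Delta_\kappa f]$ for $f,g\in C^2(\mathbb{R}^d)$; explicitly $\Gamma(f,g)(x)=\langle\nabla f(x),\nabla g(x)\rangle+\sum_{\alpha\in\mathfrak{R}_+}\kappa_\alpha\frac{(f(x)-f(r_\alpha x))(g(x)-g(r_\alpha x))}{\langle\alpha,x\rangle^2}$. For $f,g\in C^4(\mathbb{R}^d)$, $\Gamma_2(f,g)=\frac12[\Delta_\kappa\Gamma(f,g)-\Gamma(\Delta_\kappa f,g)-\Gamma(f,\Delta_\kappa g)]$, and $\Gamma_2(f)=\Gamma_2(f,f)$. *)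

theory Defs
  imports "HOL-Analysis.Analysis" "HOL-Algebra.Bij" "HOL-Algebra.Product_Groups"
begin

section \<open>Differential calculus on Euclidean space\<close>

definition partial_deriv :: "'n::finite \<Rightarrow> (real^'n \<Rightarrow> real) \<Rightarrow> real^'n \<Rightarrow> real" where
  "partial_deriv i f x = frechet_derivative f (at x) (axis i 1)"

primrec C_class :: "nat \<Rightarrow> (real^'n::finite \<Rightarrow> real) \<Rightarrow> bool" where
  "C_class 0 f \<longleftrightarrow> continuous_on UNIV f"
| "C_class (Suc k) f \<longleftrightarrow> (\<forall>x. f differentiable (at x)) \<and> (\<forall>i. C_class k (partial_deriv i f))"

definition grad :: "(real^'n::finite \<Rightarrow> real) \<Rightarrow> real^'n \<Rightarrow> real^'n" where
  "grad f x = (\<chi> i. partial_deriv i f x)"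

definition hessian :: "(real^'n::finite \<Rightarrow> real) \<Rightarrow> real^'n \<Rightarrow> real^'n^'n" where
  "hessian f x = (\<chi> i j. partial_deriv i (partial_deriv j f) x)"

definition laplacian :: "(real^'n::finite \<Rightarrow> real) \<Rightarrow> real^'n \<Rightarrow> real" where
  "laplacian f x = (\<Sum>i\<in>UNIV. partial_deriv i (partial_deriv i f) x)"

definition hs_norm :: "real^'n^'m \<Rightarrow> real" where
  "hs_norm A = sqrt (\<Sum>i\<in>UNIV. \<Sum>j\<in>UNIV. (A $ i $ j)\<^sup>2)"

section \<open>Root systems and Weyl groups\<close>

definition root_reflection :: "real^'n::finite \<Rightarrow> real^'n \<Rightarrow> real^'n" where
  "root_reflection \<alpha> x = x - (2 * (\<alpha> \<bullet> x) / (norm \<alpha>)\<^sup>2) *\<^sub>R \<alpha>"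

definition root_system :: "(real^'n::finite) set \<Rightarrow> bool" where
  "root_system R \<longleftrightarrow> finite R \<and> R \<noteq> {} \<and> 0 \<notin> R \<and>
     (\<forall>\<alpha>\<in>R. R \<inter> range (\<lambda>c. c *\<^sub>R \<alpha>) = {\<alpha>, -\<alpha>} \<and> root_reflection \<alpha> ` R = R)"

definition normalized_root_system :: "(real^'n::finite) set \<Rightarrow> bool" where
  "normalized_root_system R \<longleftrightarrow> root_system R \<and> (\<forall>\<alpha>\<in>R. norm \<alpha> = sqrt 2)"

definition positive_roots :: "(real^'n::finite) set \<Rightarrow> real^'n \<Rightarrow> (real^'n) set" where
  "positive_roots R y = {\<alpha>\<in>R. \<alpha> \<bullet> y > 0}"

definition weyl_group :: "(real^'n::finite) set \<Rightarrow> (real^'n \<Rightarrow> real^'n) monoid" where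
  "weyl_group R = subgroup_generated (BijGroup UNIV) (root_reflection ` R)"

definition invariant_multiplicity :: "(real^'n::finite) set \<Rightarrow> (real^'n \<Rightarrow> real) \<Rightarrow> bool" where
  "invariant_multiplicity R \<kappa> \<longleftrightarrow>
     (\<forall>\<alpha>\<in>R. \<kappa> \<alpha> \<ge> 0) \<and> (\<forall>g\<in>carrier (weyl_group R). \<forall>\<alpha>\<in>R. \<kappa> (g \<alpha>) = \<kappa> \<alpha>)"

section \<open>The Dunkl Laplacian and the iterated square-field operators\<close>

text \<open>
  A function given by a formula on \<open>S\<close> is extended to the closure of \<open>S\<close> by its limit from
  within \<open>S\<close>. The value is meaningful only where that limit exists; for the quotients below this
  holds whenever the function is of class \<open>C\<^sup>2\<close>.
\<close>

definition continuous_extension ::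
  "(real^'n::finite) set \<Rightarrow> (real^'n \<Rightarrow> real) \<Rightarrow> real^'n \<Rightarrow> real" where
  "continuous_extension S h x = (if x \<in> S then h x else Lim (at x within S) h)"

definition dunkl_term :: "real^'n::finite \<Rightarrow> (real^'n \<Rightarrow> real) \<Rightarrow> real^'n \<Rightarrow> real" where
  "dunkl_term \<alpha> f = continuous_extension {z. \<alpha> \<bullet> z \<noteq> 0}
     (\<lambda>z. (\<alpha> \<bullet> grad f z) / (\<alpha> \<bullet> z) - (f z - f (root_reflection \<alpha> z)) / (\<alpha> \<bullet> z)\<^sup>2)"

text \<open>In the following definitions \<open>P\<close> is the set of positive roots.\<close>

definition dunkl_laplacian ::
  "(real^'n::finite) set \<Rightarrow> (real^'n \<Rightarrow> real) \<Rightarrow> (real^'n \<Rightarrow> real) \<Rightarrow> real^'n \<Rightarrow> real" where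
  "dunkl_laplacian P \<kappa> f x = laplacian f x + 2 * (\<Sum>\<alpha>\<in>P. \<kappa> \<alpha> * dunkl_term \<alpha> f x)"

definition carre_du_champ ::
  "(real^'n::finite) set \<Rightarrow> (real^'n \<Rightarrow> real) \<Rightarrow> (real^'n \<Rightarrow> real) \<Rightarrow> (real^'n \<Rightarrow> real) \<Rightarrow> real^'n \<Rightarrow> real"
where
  "carre_du_champ P \<kappa> f g x =
     (dunkl_laplacian P \<kappa> (\<lambda>z. f z * g z) x
       - f x * dunkl_laplacian P \<kappa> g x - g x * dunkl_laplacian P \<kappa> f x) / 2"

definition Gamma2 ::
  "(real^'n::finite) set \<Rightarrow> (real^'n \<Rightarrow> real) \<Rightarrow> (real^'n \<Rightarrow> real) \<Rightarrow> (real^'n \<Rightarrow> real) \<Rightarrow> real^'n \<Rightarrow> real"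
where
  "Gamma2 P \<kappa> f g x =
     (dunkl_laplacian P \<kappa> (carre_du_champ P \<kappa> f g) x
       - carre_du_champ P \<kappa> (dunkl_laplacian P \<kappa> f) g x
       - carre_du_champ P \<kappa> f (dunkl_laplacian P \<kappa> g) x) / 2"

end

(*
  Two distinct commuting reflections have orthogonal roots, so the hypothesis on G makes the
  positive roots pairwise orthogonal. For a root \<alpha> write t = <\<alpha>, x> and
    d f = (f - f o r_\<alpha>) / t  (refl_quotient),    T f = (<\<alpha>, grad f> - d f) / t  (dunkl_part).
  Taylor's formula along the segment from x to r_\<alpha> x, whose points are x - s t \<alpha>, turns both
  quotients into integrals over s in [0,1] of derivatives of f, which are regular across t = 0: d
  loses one derivative and T loses two. Hence the Dunkl Laplacian maps C^(k+2) to C^k, and both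
  sides of the inequality are continuous, so it suffices to prove it where no <\<alpha>, x> vanishes.
  There Bochner's formula and an explicit computation give
    Gamma_2(f) = |Hess f|^2 + 2 sum_\<alpha> \<kappa>_\<alpha> (|grad d_\<alpha> f|^2 + (T_\<alpha> f)^2)
                 + sum_(\<alpha> <> \<beta>) \<kappa>_\<alpha> \<kappa>_\<beta> (d_\<beta> d_\<alpha> f)^2;
  the diagonal terms with \<alpha> = \<beta> cancel, and orthogonality makes d_\<alpha> and T_\<beta> compatible.
*)
theory Submission
  imports Defs
begin

section \<open>Functions of class \<open>C\<^sup>k\<close>\<close>

lemma GDERIV_grad:
  fixes f :: "real^'n::finite \<Rightarrow> real"
  assumes "f differentiable (at x)"
  shows "GDERIV f x :> grad f x"
proof -
  let ?D = "frechet_derivative f (at x)"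
  have D: "(f has_derivative ?D) (at x)"
    using assms frechet_derivative_works by blast
  have lin: "linear ?D"
    using D has_derivative_linear by blast
  have "?D h = h \<bullet> grad f x" for h
  proof -
    have "?D h = ?D (\<Sum>i\<in>UNIV. (h $ i) *\<^sub>R axis i 1)"
      by (simp add: basis_expansion scalar_mult_eq_scaleR[symmetric])
    also have "\<dots> = (\<Sum>i\<in>UNIV. h $ i * partial_deriv i f x)"
      by (simp add: linear_sum[OF lin] linear_cmul[OF lin] partial_deriv_def)
    finally show ?thesis
      by (simp add: grad_def inner_vec_def)
  qed
  then have "?D = (\<lambda>h. h \<bullet> grad f x)"
    by blast
  then show ?thesis
    unfolding gderiv_def using D by simp
qed

lemma GDERIV_imp_differentiable: "GDERIV f x :> D \<Longrightarrow> f differentiable (at x)"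
  unfolding gderiv_def differentiable_def by blast

lemma grad_nth [simp]: "grad f x $ i = partial_deriv i f x"
  by (simp add: grad_def)

lemma GDERIV_imp_grad:
  fixes f :: "real^'n::finite \<Rightarrow> real"
  assumes "GDERIV f x :> D"
  shows "grad f x = D"
proof -
  have "frechet_derivative f (at x) = (\<lambda>h. h \<bullet> D)"
    using assms frechet_derivative_at unfolding gderiv_def by metis
  then show ?thesis
    by (simp add: vec_eq_iff partial_deriv_def inner_axis inner_commute)
qed

lemma GDERIV_inner_left: "GDERIV (\<lambda>x. a \<bullet> x) x :> a"
  unfolding gderiv_def by (auto intro!: derivative_eq_intros simp: inner_commute)

text \<open>Smoothness is proved in this form throughout: a differentiation rule supplies a gradient
  field, and its components are shown to be C^k, mostly by induction on k.\<close>

lemma C_class_SucI: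
  assumes "\<And>x. GDERIV f x :> G x" and "\<And>i. C_class k (\<lambda>x. G x $ i)"
  shows "C_class (Suc k) f"
proof -
  have "partial_deriv i f = (\<lambda>x. G x $ i)" for i
    by (rule ext) (simp flip: GDERIV_imp_grad[OF assms(1)])
  then show ?thesis
    using assms(2) GDERIV_imp_differentiable[OF assms(1)] by simp
qed

lemma C_class_Suc_GDERIV: "C_class (Suc k) f \<Longrightarrow> GDERIV f x :> grad f x"
  by (simp add: GDERIV_grad)

lemma C_class_Suc_grad: "C_class (Suc k) f \<Longrightarrow> C_class k (\<lambda>x. grad f x $ i)"
  by simp

lemma C_class_SucD: "C_class (Suc k) f \<Longrightarrow> C_class k f"
proof (induction k arbitrary: f)
  case 0
  then show ?case
    by (simp add: differentiable_imp_continuous_within continuous_at_imp_continuous_on)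
qed auto

declare C_class.simps(2) [simp del]

lemma C_class_partial_deriv: "C_class (Suc k) f \<Longrightarrow> C_class k (partial_deriv i f)"
  by (simp add: C_class.simps)

lemma C_class_mono:
  assumes "C_class m f" and "k \<le> m"
  shows "C_class k f"
  using assms(2,1) by (induction rule: inc_induct) (auto dest: C_class_SucD)

lemma C_class_continuous: "C_class k f \<Longrightarrow> continuous_on UNIV f"
  using C_class_mono[of k f 0] by simp

lemma C_class_const: "C_class k (\<lambda>x. c)"
proof (induction k arbitrary: c)
  case (Suc k)
  show ?case
    by (rule C_class_SucI[where G = "\<lambda>_. 0"]) (use Suc in \<open>auto simp: GDERIV_const\<close>)
qed auto

lemma C_class_add:
  assumes "C_class k f" and "C_class k g"
  shows "C_class k (\<lambda>x. f x + g x)"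
  using assms
proof (induction k arbitrary: f g)
  case (Suc k)
  show ?case
    by (rule C_class_SucI[OF GDERIV_add[OF C_class_Suc_GDERIV C_class_Suc_GDERIV], OF Suc.prems])
      (simp add: Suc C_class_partial_deriv)
qed (auto intro: continuous_intros)

lemma C_class_mult:
  assumes "C_class k f" and "C_class k g"
  shows "C_class k (\<lambda>x. f x * g x)"
  using assms
proof (induction k arbitrary: f g)
  case (Suc k)
  have C: "C_class k f" "C_class k g"
    using Suc.prems by (auto dest: C_class_SucD)
  have "C_class k (\<lambda>x. (f x *\<^sub>R grad g x + g x *\<^sub>R grad f x) $ i)" for i
    using Suc.IH[OF C(1) C_class_Suc_grad[OF Suc.prems(2)]]
      Suc.IH[OF C(2) C_class_Suc_grad[OF Suc.prems(1)]]
    by (simp add: C_class_add)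
  then show ?case
    by (rule C_class_SucI[OF GDERIV_mult[OF C_class_Suc_GDERIV C_class_Suc_GDERIV], OF Suc.prems])
qed (auto intro: continuous_intros)

lemma C_class_cmult: "C_class k f \<Longrightarrow> C_class k (\<lambda>x. c * f x)"
  by (intro C_class_mult C_class_const)

lemma C_class_diff: "C_class k f \<Longrightarrow> C_class k g \<Longrightarrow> C_class k (\<lambda>x. f x - g x)"
  using C_class_add[of k f "\<lambda>x. -1 * g x"] C_class_cmult[of k g "-1"] by simp

lemma C_class_sum:
  assumes "\<And>i. i \<in> I \<Longrightarrow> C_class k (f i)"
  shows "C_class k (\<lambda>x. \<Sum>i\<in>I. f i x)"
  using assms
  by (induction I rule: infinite_finite_induct) (auto intro: C_class_const C_class_add)

lemma C_class_inner_left: "C_class k (\<lambda>x. a \<bullet> x)"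
proof (cases k)
  case (Suc m)
  then show ?thesis
    using C_class_SucI[OF GDERIV_inner_left, of m a] C_class_const by blast
qed (auto intro: continuous_intros)

section \<open>Directional derivatives and the symmetry of second derivatives\<close>

text \<open>Both coordinate axes and roots occur as directions, so one operator serves for all of
  them; the direction \<open>axis i 1\<close> gives the partial derivatives.\<close>

definition dir_deriv :: "real^'n::finite \<Rightarrow> (real^'n \<Rightarrow> real) \<Rightarrow> real^'n \<Rightarrow> real" where
  "dir_deriv a f x = a \<bullet> grad f x"

lemma dir_deriv_eq_sum: "dir_deriv a f x = (\<Sum>i\<in>UNIV. a $ i * partial_deriv i f x)"
  by (simp add: dir_deriv_def inner_vec_def)

lemma partial_deriv_eq_dir_deriv: "partial_deriv i f = dir_deriv (axis i 1) f"
  by (rule ext) (simp add: dir_deriv_def inner_axis inner_commute)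

lemma C_class_dir_deriv: "C_class (Suc k) f \<Longrightarrow> C_class k (dir_deriv a f)"
  unfolding dir_deriv_eq_sum[abs_def] by (intro C_class_sum C_class_cmult C_class_partial_deriv)

lemma C_class_inner_grad:
  "C_class (Suc k) f \<Longrightarrow> C_class (Suc k) g \<Longrightarrow> C_class k (\<lambda>x. grad f x \<bullet> grad g x)"
  unfolding inner_vec_def by (intro C_class_sum) (simp add: C_class_mult C_class_partial_deriv)

lemma C_class_laplacian: "C_class (Suc (Suc k)) f \<Longrightarrow> C_class k (laplacian f)"
  unfolding laplacian_def[abs_def] by (intro C_class_sum C_class_partial_deriv)

lemma has_real_derivative_along_line:
  assumes "C_class (Suc k) f"
  shows "((\<lambda>s. f (p + s *\<^sub>R a)) has_real_derivative dir_deriv a f (p + s *\<^sub>R a)) (at s within S)"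
proof -
  have *: "(f has_derivative (\<lambda>h. h \<bullet> grad f (p + s *\<^sub>R a))) (at (p + s *\<^sub>R a))"
    using C_class_Suc_GDERIV[OF assms] unfolding gderiv_def by blast
  have "((\<lambda>s. f (p + s *\<^sub>R a)) has_derivative (\<lambda>h. (h *\<^sub>R a) \<bullet> grad f (p + s *\<^sub>R a))) (at s within S)"
    by (rule has_derivative_compose[where f = "\<lambda>s. p + s *\<^sub>R a", OF _ *]) (auto intro!: derivative_eq_intros)
  moreover have "(\<lambda>h. (h *\<^sub>R a) \<bullet> grad f (p + s *\<^sub>R a)) = (*) (dir_deriv a f (p + s *\<^sub>R a))"
    by (rule ext) (simp add: dir_deriv_def)
  ultimately show ?thesis
    by (simp add: has_field_derivative_def)
qed

text \<open>Schwarz's theorem. The second difference of f over a small parallelogram with sides h a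
  and h b is symmetric in a and b. The mean value theorem, used in either order of the two
  directions, turns it into h^2 times one or the other mixed derivative at a point near x.\<close>

lemma dir_deriv_commute:
  fixes f :: "real^'n::finite \<Rightarrow> real"
  assumes f: "C_class (Suc (Suc k)) f"
  shows "dir_deriv a (dir_deriv b f) x = dir_deriv b (dir_deriv a f) x"
proof -
  \<comment> \<open>Refuting one strict inequality is enough: the opposite one is the same claim
    with a and b exchanged.\<close>
  have *: False if less: "dir_deriv a (dir_deriv b f) x < dir_deriv b (dir_deriv a f) x"
    for a b :: "real^'n"
  proof -
    have C: "C_class (Suc k) (dir_deriv c f)" for c
      using f by (rule C_class_dir_deriv)
    have cont: "continuous_on UNIV (dir_deriv c (dir_deriv c' f))" for c c'
      using C_class_dir_deriv[OF C] by (rule C_class_continuous)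
    \<comment> \<open>The number m separates the two mixed derivatives at x and, by continuity, on a
      whole ball around x.\<close>
    obtain m where m: "dir_deriv a (dir_deriv b f) x < m" "m < dir_deriv b (dir_deriv a f) x"
      using dense[OF less] by blast
    let ?U = "{z. dir_deriv a (dir_deriv b f) z < m} \<inter> {z. m < dir_deriv b (dir_deriv a f) z}"
    have "open ?U"
      by (intro open_Int open_Collect_less cont continuous_on_const)
    moreover have "x \<in> ?U"
      using m by simp
    ultimately obtain e where e: "e > 0" "ball x e \<subseteq> ?U"
      by (meson open_contains_ball)
    \<comment> \<open>The summand 1 keeps N positive even if a = b = 0. With h = e / (2 N) the whole
      parallelogram stays within distance e / 2 of x.\<close>
    define N where "N = norm a + norm b + 1"
    have N: "N > 0"
      unfolding N_def by (simp add: add_nonneg_pos)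
    define h where "h = e / (2 * N)"
    have h: "h > 0"
      unfolding h_def using e N by simp
    have in_ball: "x + u *\<^sub>R a + v *\<^sub>R b \<in> ?U" if "0 \<le> u" "u \<le> h" "0 \<le> v" "v \<le> h" for u v
    proof -
      have "norm (u *\<^sub>R a + v *\<^sub>R b) \<le> u * norm a + v * norm b"
        using norm_triangle_ineq[of "u *\<^sub>R a" "v *\<^sub>R b"] that by simp
      also have "\<dots> \<le> h * norm a + h * norm b"
        using that by (intro add_mono mult_right_mono) auto
      also have "\<dots> < h * N"
        unfolding N_def using h by (simp add: distrib_left)
      also have "\<dots> = e / 2"
        using N by (simp add: h_def)
      also have "\<dots> < e"
        using e by simp
      finally have "x + u *\<^sub>R a + v *\<^sub>R b \<in> ball x e"
        unfolding mem_ball by (subst dist_commute) (simp add: dist_norm add.assoc)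
      then show ?thesis
        using e by blast
    qed
    have key: "\<exists>u v. 0 < u \<and> u < h \<and> 0 < v \<and> v < h \<and>
      f (x + h *\<^sub>R c + h *\<^sub>R d) - f (x + h *\<^sub>R d) - f (x + h *\<^sub>R c) + f x
        = h * h * dir_deriv d (dir_deriv c f) (x + u *\<^sub>R c + v *\<^sub>R d)" for c d :: "real^'n"
    proof -
      \<comment> \<open>First mean value theorem in direction c, for the difference of f along two
        parallel lines a step h d apart; what remains is an increment of
        \<open>dir_deriv c f\<close> in direction d, to which the theorem is applied again.\<close>
      have "\<exists>u>0. u < h \<and> (f ((x + h *\<^sub>R d) + h *\<^sub>R c) - f (x + h *\<^sub>R c)) - (f ((x + h *\<^sub>R d) + 0 *\<^sub>R c) - f (x + 0 *\<^sub>R c))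
        = (h - 0) * (dir_deriv c f ((x + h *\<^sub>R d) + u *\<^sub>R c) - dir_deriv c f (x + u *\<^sub>R c))"
        by (rule MVT2[where f = "\<lambda>s. f ((x + h *\<^sub>R d) + s *\<^sub>R c) - f (x + s *\<^sub>R c)", OF h
            DERIV_diff[OF has_real_derivative_along_line[OF f] has_real_derivative_along_line[OF f]]])
      then obtain u where u: "0 < u" "u < h" and
        eq1: "(f ((x + h *\<^sub>R d) + h *\<^sub>R c) - f (x + h *\<^sub>R c)) - (f ((x + h *\<^sub>R d) + 0 *\<^sub>R c) - f (x + 0 *\<^sub>R c))
        = (h - 0) * (dir_deriv c f ((x + h *\<^sub>R d) + u *\<^sub>R c) - dir_deriv c f (x + u *\<^sub>R c))"
        by blast
      have "\<exists>v>0. v < h \<and> dir_deriv c f (x + u *\<^sub>R c + h *\<^sub>R d) - dir_deriv c f (x + u *\<^sub>R c + 0 *\<^sub>R d)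
        = (h - 0) * dir_deriv d (dir_deriv c f) (x + u *\<^sub>R c + v *\<^sub>R d)"
        by (rule MVT2[where f = "\<lambda>s. dir_deriv c f (x + u *\<^sub>R c + s *\<^sub>R d)", OF h
            has_real_derivative_along_line[OF C]])
      then obtain v where v: "0 < v" "v < h" and
        eq2: "dir_deriv c f (x + u *\<^sub>R c + h *\<^sub>R d) - dir_deriv c f (x + u *\<^sub>R c + 0 *\<^sub>R d)
        = (h - 0) * dir_deriv d (dir_deriv c f) (x + u *\<^sub>R c + v *\<^sub>R d)"
        by blast
      have "f (x + h *\<^sub>R c + h *\<^sub>R d) - f (x + h *\<^sub>R d) - f (x + h *\<^sub>R c) + f x
        = h * h * dir_deriv d (dir_deriv c f) (x + u *\<^sub>R c + v *\<^sub>R d)"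
      proof -
        have swap: "x + h *\<^sub>R d + s *\<^sub>R c = x + s *\<^sub>R c + h *\<^sub>R d" for s
          by (simp only: add.assoc add.commute[of "h *\<^sub>R d"])
        have "f (x + h *\<^sub>R c + h *\<^sub>R d) - f (x + h *\<^sub>R d) - f (x + h *\<^sub>R c) + f x
          = h * (dir_deriv c f (x + u *\<^sub>R c + h *\<^sub>R d) - dir_deriv c f (x + u *\<^sub>R c))"
          using eq1 unfolding swap by simp
        then show ?thesis
          using eq2 by simp
      qed
      then show ?thesis
        using u v by blast
    qed
    obtain u v where uv: "0 < u" "u < h" "0 < v" "v < h"
      and Q1: "f (x + h *\<^sub>R a + h *\<^sub>R b) - f (x + h *\<^sub>R b) - f (x + h *\<^sub>R a) + f x
        = h * h * dir_deriv b (dir_deriv a f) (x + u *\<^sub>R a + v *\<^sub>R b)"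
      using key[of a b] by blast
    obtain u' v' where uv': "0 < u'" "u' < h" "0 < v'" "v' < h"
      and Q2: "f (x + h *\<^sub>R b + h *\<^sub>R a) - f (x + h *\<^sub>R a) - f (x + h *\<^sub>R b) + f x
        = h * h * dir_deriv a (dir_deriv b f) (x + v' *\<^sub>R b + u' *\<^sub>R a)"
      using key[of b a] by blast
    have "h * h * dir_deriv b (dir_deriv a f) (x + u *\<^sub>R a + v *\<^sub>R b)
      = h * h * dir_deriv a (dir_deriv b f) (x + u' *\<^sub>R a + v' *\<^sub>R b)"
    proof -
      have swap: "x + s *\<^sub>R b + t *\<^sub>R a = x + t *\<^sub>R a + s *\<^sub>R b" for s t
        by (simp only: add.assoc add.commute[of "s *\<^sub>R b"])
      show ?thesis
        using Q1 Q2 unfolding swap by linarith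
    qed
    then have "dir_deriv b (dir_deriv a f) (x + u *\<^sub>R a + v *\<^sub>R b)
      = dir_deriv a (dir_deriv b f) (x + u' *\<^sub>R a + v' *\<^sub>R b)"
      using h by simp
    moreover have "x + u *\<^sub>R a + v *\<^sub>R b \<in> ?U" "x + u' *\<^sub>R a + v' *\<^sub>R b \<in> ?U"
      by (rule in_ball; use uv uv' in simp)+
    ultimately show False
      by simp
  qed
  show ?thesis
    using *[of a b] *[of b a] by (meson linorder_neqE)
qed

section \<open>Integrals along the segment from a point to its reflection\<close>

text \<open>If |\<alpha>|^2 = 2, then s = 0 gives the identity and s = 1 the reflection, and the
  values between trace the segment from x to its mirror image. For fixed s the map is linear and
  self-adjoint in x.\<close>

definition shear :: "real^'n::finite \<Rightarrow> real \<Rightarrow> real^'n \<Rightarrow> real^'n" where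
  "shear \<alpha> s x = x - (s * (\<alpha> \<bullet> x)) *\<^sub>R \<alpha>"

text \<open>A linear map is its own derivative, and this one is self-adjoint, so the chain rule
  applies the shear to g; the gradient on the right is \<open>shear \<alpha> s g\<close> written
  out.\<close>

lemma GDERIV_compose_shear:
  assumes "GDERIV h (shear \<alpha> s x) :> g"
  shows "GDERIV (\<lambda>x. h (shear \<alpha> s x)) x :> g - (s * (\<alpha> \<bullet> g)) *\<^sub>R \<alpha>"
proof -
  have "(shear \<alpha> s has_derivative shear \<alpha> s) (at x)"
    unfolding shear_def[abs_def] by (auto intro!: derivative_eq_intros)
  from has_derivative_compose[OF this assms[unfolded gderiv_def]]
  have "((\<lambda>x. h (shear \<alpha> s x)) has_derivative (\<lambda>k. shear \<alpha> s k \<bullet> g)) (at x)" .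
  moreover have "(\<lambda>k. shear \<alpha> s k \<bullet> g) = (\<lambda>k. k \<bullet> (g - (s * (\<alpha> \<bullet> g)) *\<^sub>R \<alpha>))"
    by (rule ext) (simp add: shear_def inner_diff_left inner_diff_right inner_commute mult_ac)
  ultimately show ?thesis
    by (simp add: gderiv_def)
qed

text \<open>The weight w stays arbitrary because each derivative in x brings out a factor s: only
  the family over all continuous weights is closed under differentiation.\<close>

definition shear_integral ::
  "(real \<Rightarrow> real) \<Rightarrow> real^'n::finite \<Rightarrow> (real^'n \<Rightarrow> real) \<Rightarrow> real^'n \<Rightarrow> real" where
  "shear_integral w \<alpha> h x = integral {0..1} (\<lambda>s. w s * h (shear \<alpha> s x))"

lemma continuous_on_shear_pair:
  assumes "continuous_on UNIV h"
  shows "continuous_on S (\<lambda>(x, s). h (shear \<alpha> s x))"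
  unfolding split_beta shear_def
  by (rule continuous_on_compose2[OF assms]) (auto intro!: continuous_intros)

lemma continuous_on_shear:
  assumes "continuous_on UNIV h"
  shows "continuous_on S (\<lambda>s. h (shear \<alpha> s x))"
  unfolding shear_def
  by (rule continuous_on_compose2[OF assms]) (auto intro!: continuous_intros)

lemma continuous_on_weighted_shear_pair:
  fixes w :: "real \<Rightarrow> real"
  assumes "continuous_on {0..1} w" and "continuous_on UNIV h"
  shows "continuous_on (UNIV \<times> {0..1}) (\<lambda>(x, s). w s * h (shear \<alpha> s x))"
proof -
  have "continuous_on (UNIV \<times> {0..1::real}) (\<lambda>p. w (snd p))"
    by (rule continuous_on_compose2[OF assms(1)]) (auto intro!: continuous_intros)
  then show ?thesis
    using continuous_on_shear_pair[OF assms(2)] unfolding split_beta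
    by (rule continuous_on_mult)
qed

lemma integrable_shear:
  fixes w :: "real \<Rightarrow> real"
  assumes "continuous_on {0..1} w" and "continuous_on UNIV h"
  shows "(\<lambda>s. w s * h (shear \<alpha> s x)) integrable_on {0..1}"
  by (intro integrable_continuous_real continuous_intros assms continuous_on_shear)

text \<open>Differentiation under the integral sign. The identity part of the shear keeps the weight
  w, its rank-one part along \<alpha> multiplies the weight by s.\<close>

lemma GDERIV_shear_integral:
  fixes h :: "real^'n::finite \<Rightarrow> real"
  assumes w: "continuous_on {0..1} w" and h: "C_class (Suc k) h"
  shows "GDERIV (shear_integral w \<alpha> h) x :>
    (\<chi> i. shear_integral w \<alpha> (partial_deriv i h) x
      - \<alpha> $ i * shear_integral (\<lambda>s. w s * s) \<alpha> (dir_deriv \<alpha> h) x)"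
proof -
  define G where "G s x = grad h (shear \<alpha> s x) - (s * (\<alpha> \<bullet> grad h (shear \<alpha> s x))) *\<^sub>R \<alpha>" for s x
  have cont_h: "continuous_on UNIV h"
    using h by (rule C_class_continuous)
  have cont_partial: "continuous_on UNIV (partial_deriv i h)" for i
    using C_class_partial_deriv[OF h] by (rule C_class_continuous)
  have cont_dir: "continuous_on UNIV (dir_deriv \<alpha> h)"
    using C_class_dir_deriv[OF h] by (rule C_class_continuous)
  have cont_grad: "continuous_on UNIV (grad h)"
    unfolding grad_def[abs_def] by (rule continuous_on_vec_lambda) (rule cont_partial)
  have cont_grad_pair: "continuous_on (UNIV \<times> {0..1}) (\<lambda>p. grad h (shear \<alpha> (snd p) (fst p)))"
    unfolding shear_def
    by (rule continuous_on_compose2[OF cont_grad]) (auto intro!: continuous_intros)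
  have cont_w_pair: "continuous_on (UNIV \<times> {0..1::real}) (\<lambda>p. w (snd p))"
    by (rule continuous_on_compose2[OF w]) (auto intro!: continuous_intros)
  have cont_G: "continuous_on (UNIV \<times> {0..1}) (\<lambda>p. w (snd p) *\<^sub>R G (snd p) (fst p))"
    unfolding G_def by (intro continuous_intros cont_w_pair cont_grad_pair)
  \<comment> \<open>The Leibniz rule takes the derivative as a continuous map into bounded linear
    functionals; \<open>blinfun_inner_left\<close> turns a gradient vector into such a
    functional.\<close>
  have deriv: "((\<lambda>x. w s * h (shear \<alpha> s x)) has_derivative
      blinfun_inner_left (w s *\<^sub>R G s x)) (at x within UNIV)" for x s
  proof -
    have "GDERIV (\<lambda>x. w s * h (shear \<alpha> s x)) x :> w s *\<^sub>R G s x + h (shear \<alpha> s x) *\<^sub>R 0"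
      unfolding G_def
      by (intro GDERIV_mult GDERIV_const GDERIV_compose_shear C_class_Suc_GDERIV[OF h])
    then show ?thesis
      by (simp add: gderiv_def blinfun_inner_left.rep_eq)
  qed
  have cont_bl: "continuous_on (UNIV \<times> cbox 0 1) (\<lambda>(x, s). blinfun_inner_left (w s *\<^sub>R G s x))"
    using bounded_linear.continuous_on[OF bounded_linear_blinfun_inner_left cont_G]
    by (simp add: split_beta)
  have "((\<lambda>x. integral (cbox 0 1) (\<lambda>s. w s * h (shear \<alpha> s x))) has_derivative
      integral (cbox 0 1) (\<lambda>s. blinfun_inner_left (w s *\<^sub>R G s x))) (at x within UNIV)"
    by (rule leibniz_rule[OF deriv _ cont_bl])
      (use integrable_shear[OF w cont_h] in auto)
  moreover have int_G: "(\<lambda>s. w s *\<^sub>R G s x) integrable_on {0..1}"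
  proof (rule integrable_continuous_real)
    have "continuous_on {0..1} (\<lambda>s. w (snd (x, s)) *\<^sub>R G (snd (x, s)) (fst (x, s)))"
      by (rule continuous_on_compose2[OF cont_G]) (auto intro!: continuous_intros)
    then show "continuous_on {0..1} (\<lambda>s. w s *\<^sub>R G s x)"
      by simp
  qed
  have "integral {0..1} (\<lambda>s. blinfun_inner_left (w s *\<^sub>R G s x))
      = blinfun_inner_left (integral {0..1} (\<lambda>s. w s *\<^sub>R G s x))"
    using integral_linear[OF int_G bounded_linear_blinfun_inner_left] by (simp add: o_def)
  ultimately have "GDERIV (shear_integral w \<alpha> h) x :> integral {0..1} (\<lambda>s. w s *\<^sub>R G s x)"
    by (simp add: gderiv_def shear_integral_def[abs_def] blinfun_inner_left.rep_eq)
  moreover have "integral {0..1} (\<lambda>s. w s *\<^sub>R G s x) $ i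
      = shear_integral w \<alpha> (partial_deriv i h) x
        - \<alpha> $ i * shear_integral (\<lambda>s. w s * s) \<alpha> (dir_deriv \<alpha> h) x" for i
  proof -
    have ws: "continuous_on {0..1} (\<lambda>s. w s * s)"
      by (intro continuous_intros w)
    have "integral {0..1} (\<lambda>s. w s *\<^sub>R G s x) $ i = integral {0..1} (\<lambda>s. (w s *\<^sub>R G s x) $ i)"
      using integral_linear[OF int_G bounded_linear_vec_nth] by (simp add: o_def)
    also have "\<dots> = integral {0..1} (\<lambda>s. w s * partial_deriv i h (shear \<alpha> s x)
        - \<alpha> $ i * (w s * s * dir_deriv \<alpha> h (shear \<alpha> s x)))"
      by (simp add: G_def dir_deriv_def algebra_simps)
    also have "\<dots> = shear_integral w \<alpha> (partial_deriv i h) x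
        - \<alpha> $ i * shear_integral (\<lambda>s. w s * s) \<alpha> (dir_deriv \<alpha> h) x"
      unfolding shear_integral_def
      by (subst integral_diff)
        (use integrable_shear[OF w cont_partial] integrable_shear[OF ws cont_dir] in
          \<open>auto intro!: integrable_on_mult_right\<close>)
    finally show ?thesis .
  qed
  ultimately show ?thesis
    by (metis (mono_tags, lifting) vec_lambda_beta vec_eq_iff GDERIV_subst)
qed

text \<open>Induction on k for all weights at once, because the gradient involves the weight
  \<open>\<lambda>s. w s * s\<close> besides w.\<close>

lemma C_class_shear_integral:
  fixes h :: "real^'n::finite \<Rightarrow> real"
  assumes "continuous_on {0..1} w" and "C_class k h"
  shows "C_class k (shear_integral w \<alpha> h)"
  using assms
proof (induction k arbitrary: w h)
  case 0
  have "continuous_on UNIV (\<lambda>x. integral (cbox 0 1) (\<lambda>s. w s * h (shear \<alpha> s x)))"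
    by (rule integral_continuous_on_param)
      (use 0 continuous_on_weighted_shear_pair[of w h \<alpha>] in simp)
  then show ?case
    by (simp add: shear_integral_def[abs_def])
next
  case (Suc k)
  have ws: "continuous_on {0..1} (\<lambda>s. w s * s)"
    by (intro continuous_intros Suc.prems)
  have "C_class k (shear_integral w \<alpha> (partial_deriv i h))" for i
    using Suc.IH[OF Suc.prems(1)] C_class_partial_deriv[OF Suc.prems(2)] by blast
  moreover have "C_class k (shear_integral (\<lambda>s. w s * s) \<alpha> (dir_deriv \<alpha> h))"
    using Suc.IH[OF ws] C_class_dir_deriv[OF Suc.prems(2)] by blast
  ultimately show ?case
    by (intro C_class_SucI[OF GDERIV_shear_integral[OF Suc.prems]])
      (auto intro!: C_class_diff C_class_cmult)
qed

section \<open>The two singular quotients as shear integrals\<close>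

definition refl_quotient :: "real^'n::finite \<Rightarrow> (real^'n \<Rightarrow> real) \<Rightarrow> real^'n \<Rightarrow> real" where
  "refl_quotient \<alpha> f = shear_integral (\<lambda>s. 1) \<alpha> (dir_deriv \<alpha> f)"

text \<open>The weight 1 - s is that of the integral remainder in Taylor's formula; it vanishes at
  the reflected end of the segment.\<close>

definition dunkl_part :: "real^'n::finite \<Rightarrow> (real^'n \<Rightarrow> real) \<Rightarrow> real^'n \<Rightarrow> real" where
  "dunkl_part \<alpha> f = shear_integral (\<lambda>s. 1 - s) \<alpha> (dir_deriv \<alpha> (dir_deriv \<alpha> f))"

lemma C_class_refl_quotient: "C_class (Suc k) f \<Longrightarrow> C_class k (refl_quotient \<alpha> f)"
  unfolding refl_quotient_def
  by (intro C_class_shear_integral C_class_dir_deriv) (auto intro: continuous_intros)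

lemma C_class_dunkl_part: "C_class (Suc (Suc k)) f \<Longrightarrow> C_class k (dunkl_part \<alpha> f)"
  unfolding dunkl_part_def
  by (intro C_class_shear_integral C_class_dir_deriv) (auto intro: continuous_intros)

lemma has_real_derivative_shear:
  assumes "C_class (Suc k) f"
  shows "((\<lambda>s. f (shear \<alpha> s x)) has_real_derivative - ((\<alpha> \<bullet> x) * dir_deriv \<alpha> f (shear \<alpha> s x)))
    (at s within S)"
proof -
  have "shear \<alpha> s x = x + s *\<^sub>R (- (\<alpha> \<bullet> x) *\<^sub>R \<alpha>)" for s
    by (simp add: shear_def)
  then show ?thesis
    using has_real_derivative_along_line[OF assms, of x "- (\<alpha> \<bullet> x) *\<^sub>R \<alpha>" s S]
    by (simp add: dir_deriv_def)
qed

text \<open>The fundamental theorem of calculus along the segment. Unlike the quotient, the product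
  form also holds on the hyperplane <\<alpha>, x> = 0, so both sides can be differentiated in x; the
  gradient and Laplacian of \<open>refl_quotient\<close> are found that way.\<close>

lemma inner_mult_refl_quotient:
  assumes "C_class (Suc k) f"
  shows "(\<alpha> \<bullet> x) * refl_quotient \<alpha> f x = f x - f (shear \<alpha> 1 x)"
proof -
  have "((\<lambda>s. - ((\<alpha> \<bullet> x) * dir_deriv \<alpha> f (shear \<alpha> s x))) has_integral
      f (shear \<alpha> 1 x) - f (shear \<alpha> 0 x)) {0..1}"
    by (rule fundamental_theorem_of_calculus)
      (use has_real_derivative_shear[OF assms] in
        \<open>auto simp: has_real_derivative_iff_has_vector_derivative\<close>)
  from integral_unique[OF this] show ?thesis
    by (simp add: refl_quotient_def shear_integral_def) (simp add: shear_def)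
qed

text \<open>Integration by parts along the segment: the factor 1 - s removes the boundary term at
  the reflected point, and its derivative produces \<open>refl_quotient\<close>.\<close>

lemma inner_mult_dunkl_part:
  assumes f: "C_class (Suc (Suc k)) f"
  shows "(\<alpha> \<bullet> x) * dunkl_part \<alpha> f x = dir_deriv \<alpha> f x - refl_quotient \<alpha> f x"
proof -
  let ?g = "dir_deriv \<alpha> f" and ?t = "\<alpha> \<bullet> x"
  have g: "C_class (Suc k) ?g"
    using f by (rule C_class_dir_deriv)
  have ints: "(\<lambda>s. (1 - s) * dir_deriv \<alpha> ?g (shear \<alpha> s x)) integrable_on {0..1}"
    "(\<lambda>s. 1 * ?g (shear \<alpha> s x)) integrable_on {0..1}"
    by (intro integrable_shear continuous_intros C_class_continuous[OF g]
        C_class_continuous[OF C_class_dir_deriv[OF g]])+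
  have "((\<lambda>s. - (?t * ((1 - s) * dir_deriv \<alpha> ?g (shear \<alpha> s x))) - 1 * ?g (shear \<alpha> s x))
      has_integral (1 - 1) * ?g (shear \<alpha> 1 x) - (1 - 0) * ?g (shear \<alpha> 0 x)) {0..1}"
  proof (rule fundamental_theorem_of_calculus)
    fix s :: real
    have "((\<lambda>s. (1 - s) * ?g (shear \<alpha> s x)) has_real_derivative
      (0 - 1) * ?g (shear \<alpha> s x) + - (?t * dir_deriv \<alpha> ?g (shear \<alpha> s x)) * (1 - s)) (at s within {0..1})"
      by (intro DERIV_mult DERIV_diff DERIV_const DERIV_ident has_real_derivative_shear[OF g])
    then show "((\<lambda>s. (1 - s) * ?g (shear \<alpha> s x)) has_vector_derivative
        - (?t * ((1 - s) * dir_deriv \<alpha> ?g (shear \<alpha> s x))) - 1 * ?g (shear \<alpha> s x)) (at s within {0..1})"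
      by (simp add: has_real_derivative_iff_has_vector_derivative algebra_simps)
  qed simp
  from integral_unique[OF this]
  have "- (?t * dunkl_part \<alpha> f x) - refl_quotient \<alpha> f x = - ?g (shear \<alpha> 0 x)"
    unfolding dunkl_part_def refl_quotient_def shear_integral_def
    by (subst (asm) integral_diff) (use ints in \<open>auto intro!: integrable_neg integrable_on_mult_right\<close>)
  then show ?thesis
    by (simp add: shear_def)
qed

section \<open>Calculus of the Laplacian\<close>

lemma grad_add:
  assumes "C_class (Suc k) f" and "C_class (Suc k) g"
  shows "grad (\<lambda>z. f z + g z) x = grad f x + grad g x"
  by (intro GDERIV_imp_grad GDERIV_add C_class_Suc_GDERIV[OF assms(1)] C_class_Suc_GDERIV[OF assms(2)])

lemma grad_diff:
  assumes "C_class (Suc k) f" and "C_class (Suc k) g"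
  shows "grad (\<lambda>z. f z - g z) x = grad f x - grad g x"
  by (intro GDERIV_imp_grad GDERIV_diff C_class_Suc_GDERIV[OF assms(1)] C_class_Suc_GDERIV[OF assms(2)])

lemma grad_mult:
  assumes "C_class (Suc k) f" and "C_class (Suc k) g"
  shows "grad (\<lambda>z. f z * g z) x = f x *\<^sub>R grad g x + g x *\<^sub>R grad f x"
  by (intro GDERIV_imp_grad GDERIV_mult C_class_Suc_GDERIV[OF assms(1)] C_class_Suc_GDERIV[OF assms(2)])

lemma grad_const: "grad (\<lambda>z. c) x = 0"
  by (intro GDERIV_imp_grad GDERIV_const)

lemma grad_inner_left: "grad (\<lambda>z. a \<bullet> z) x = a"
  by (intro GDERIV_imp_grad GDERIV_inner_left)

lemma grad_cmult:
  assumes "C_class (Suc k) f"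
  shows "grad (\<lambda>z. c * f z) x = c *\<^sub>R grad f x"
  using grad_mult[OF C_class_const assms] by (simp add: grad_const)

lemma grad_sum:
  assumes "\<And>i. i \<in> I \<Longrightarrow> C_class (Suc k) (f i)"
  shows "grad (\<lambda>z. \<Sum>i\<in>I. f i z) x = (\<Sum>i\<in>I. grad (f i) x)"
  using assms
proof (induction I rule: infinite_finite_induct)
  case (insert i I)
  then show ?case
    using grad_add[of k "f i" "\<lambda>z. \<Sum>i\<in>I. f i z"] C_class_sum[of I "Suc k" f] by simp
qed (simp_all add: grad_const)

lemmas dir_deriv_add = grad_add[THEN arg_cong[where f = "inner a" for a],
    folded dir_deriv_def, unfolded inner_add_right, folded dir_deriv_def]

lemma dir_deriv_mult:
  assumes "C_class (Suc k) f" and "C_class (Suc k) g"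
  shows "dir_deriv a (\<lambda>z. f z * g z) x = f x * dir_deriv a g x + g x * dir_deriv a f x"
  by (simp add: dir_deriv_def grad_mult[OF assms] inner_add_right)

lemma dir_deriv_cmult:
  assumes "C_class (Suc k) f"
  shows "dir_deriv a (\<lambda>z. c * f z) x = c * dir_deriv a f x"
  by (simp add: dir_deriv_def grad_cmult[OF assms])

lemma dir_deriv_sum:
  assumes "\<And>i. i \<in> I \<Longrightarrow> C_class (Suc k) (f i)"
  shows "dir_deriv a (\<lambda>z. \<Sum>i\<in>I. f i z) x = (\<Sum>i\<in>I. dir_deriv a (f i) x)"
  by (simp add: dir_deriv_def grad_sum[OF assms] inner_sum_right)

lemma laplacian_eq: "laplacian f x = (\<Sum>i\<in>UNIV. dir_deriv (axis i 1) (dir_deriv (axis i 1) f) x)"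
  by (simp add: laplacian_def partial_deriv_eq_dir_deriv)

lemma dir_deriv_axis: "dir_deriv (axis i 1) f x = grad f x $ i"
  by (simp add: partial_deriv_eq_dir_deriv)

lemma sum_dir_deriv_axis_mult:
  "(\<Sum>i\<in>UNIV. dir_deriv (axis i 1) f x * dir_deriv (axis i 1) g x) = grad f x \<bullet> grad g x"
  by (simp only: dir_deriv_axis inner_vec_def inner_real_def)

lemma dir_deriv_mult_fun:
  assumes "C_class (Suc k) f" and "C_class (Suc k) g"
  shows "dir_deriv a (\<lambda>z. f z * g z) = (\<lambda>x. f x * dir_deriv a g x + g x * dir_deriv a f x)"
  by (rule ext) (rule dir_deriv_mult[OF assms])

lemma laplacian_mult:
  assumes f: "C_class (Suc (Suc k)) f" and g: "C_class (Suc (Suc k)) g"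
  shows "laplacian (\<lambda>z. f z * g z) x
    = f x * laplacian g x + g x * laplacian f x + 2 * (grad f x \<bullet> grad g x)"
proof -
  have f1: "C_class (Suc k) f" and g1: "C_class (Suc k) g"
    using f g C_class_SucD by blast+
  have df: "C_class (Suc k) (dir_deriv a f)" and dg: "C_class (Suc k) (dir_deriv a g)" for a
    using f g C_class_dir_deriv by blast+
  have "dir_deriv a (dir_deriv a (\<lambda>z. f z * g z)) x = f x * dir_deriv a (dir_deriv a g) x
      + g x * dir_deriv a (dir_deriv a f) x + 2 * (dir_deriv a f x * dir_deriv a g x)" for a
    unfolding dir_deriv_mult_fun[OF f1 g1]
      dir_deriv_add[OF C_class_mult[OF f1 dg] C_class_mult[OF g1 df]]
      dir_deriv_mult[OF f1 dg] dir_deriv_mult[OF g1 df]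
    by (simp add: algebra_simps)
  then show ?thesis
    unfolding laplacian_eq
    by (simp add: sum.distrib sum_distrib_left flip: sum_dir_deriv_axis_mult)
qed

lemma laplacian_add:
  assumes f: "C_class (Suc (Suc k)) f" and g: "C_class (Suc (Suc k)) g"
  shows "laplacian (\<lambda>z. f z + g z) x = laplacian f x + laplacian g x"
proof -
  have f1: "C_class (Suc k) f" and g1: "C_class (Suc k) g"
    using f g C_class_SucD by blast+
  have df: "C_class (Suc k) (dir_deriv a f)" and dg: "C_class (Suc k) (dir_deriv a g)" for a
    using f g C_class_dir_deriv by blast+
  have "dir_deriv a (\<lambda>z. f z + g z) = (\<lambda>x. dir_deriv a f x + dir_deriv a g x)" for a
    by (rule ext) (rule dir_deriv_add[OF f1 g1])
  then show ?thesis
    unfolding laplacian_eq by (simp add: dir_deriv_add[OF df dg] sum.distrib)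
qed

lemma laplacian_const: "laplacian (\<lambda>z. c) (x :: real^'n::finite) = 0"
proof -
  have "dir_deriv a (\<lambda>z. c) = (\<lambda>z. 0)" for c and a :: "real^'n"
    by (rule ext) (simp add: dir_deriv_def grad_const)
  then show ?thesis
    by (simp add: laplacian_eq)
qed

lemma laplacian_cmult:
  assumes "C_class (Suc (Suc k)) f"
  shows "laplacian (\<lambda>z. c * f z) x = c * laplacian f x"
  using laplacian_mult[OF C_class_const assms] by (simp add: grad_const laplacian_const)

lemma laplacian_diff:
  assumes "C_class (Suc (Suc k)) f" and "C_class (Suc (Suc k)) g"
  shows "laplacian (\<lambda>z. f z - g z) x = laplacian f x - laplacian g x"
  using laplacian_add[OF assms(1) C_class_cmult[OF assms(2), of "-1"]]
    laplacian_cmult[OF assms(2), of "-1"] by simp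

lemma laplacian_sum:
  assumes "\<And>i. i \<in> I \<Longrightarrow> C_class (Suc (Suc k)) (f i)"
  shows "laplacian (\<lambda>z. \<Sum>i\<in>I. f i z) x = (\<Sum>i\<in>I. laplacian (f i) x)"
  using assms
proof (induction I rule: infinite_finite_induct)
  case (insert i I)
  then show ?case
    using laplacian_add[of k "f i" "\<lambda>z. \<Sum>i\<in>I. f i z"] C_class_sum[of I "Suc (Suc k)" f] by simp
qed (simp_all add: laplacian_const)

lemma laplacian_inner_left: "laplacian (\<lambda>z. a \<bullet> z) x = 0"
proof -
  have "dir_deriv b (\<lambda>z. a \<bullet> z) = (\<lambda>z. b \<bullet> a)" for b
    by (rule ext) (simp add: dir_deriv_def grad_inner_left)
  then show ?thesis
    by (simp add: laplacian_eq dir_deriv_def grad_const)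
qed

section \<open>Reflections as shears with parameter 1\<close>

lemma root_reflection_eq_shear:
  assumes "\<alpha> \<bullet> \<alpha> = 2"
  shows "root_reflection \<alpha> = shear \<alpha> 1"
  by (rule ext) (simp add: root_reflection_def shear_def assms power2_norm_eq_inner)

lemma inner_shear_self: "\<alpha> \<bullet> \<alpha> = 2 \<Longrightarrow> \<alpha> \<bullet> shear \<alpha> 1 x = - (\<alpha> \<bullet> x)"
  by (simp add: shear_def inner_diff_right)

lemma inner_shear_orthogonal: "\<beta> \<bullet> \<alpha> = 0 \<Longrightarrow> \<beta> \<bullet> shear \<alpha> s x = \<beta> \<bullet> x"
  by (simp add: shear_def inner_diff_right)

lemma shear_shear_self: "\<alpha> \<bullet> \<alpha> = 2 \<Longrightarrow> shear \<alpha> 1 (shear \<alpha> 1 x) = x"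
  unfolding shear_def[of \<alpha> 1 "shear \<alpha> 1 x"] by (simp add: inner_shear_self) (simp add: shear_def)

lemma inner_shear_shear: "\<alpha> \<bullet> \<alpha> = 2 \<Longrightarrow> shear \<alpha> 1 x \<bullet> shear \<alpha> 1 x = x \<bullet> x"
  by (simp add: shear_def inner_diff_left inner_diff_right inner_commute algebra_simps)

lemma shear_commute: "\<alpha> \<bullet> \<beta> = 0 \<Longrightarrow> shear \<alpha> s (shear \<beta> t x) = shear \<beta> t (shear \<alpha> s x)"
  by (simp add: shear_def inner_diff_right inner_commute)

lemma GDERIV_shear:
  assumes "C_class (Suc k) f"
  shows "GDERIV (\<lambda>x. f (shear \<alpha> s x)) x :>
    grad f (shear \<alpha> s x) - (s * dir_deriv \<alpha> f (shear \<alpha> s x)) *\<^sub>R \<alpha>"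
  unfolding dir_deriv_def by (intro GDERIV_compose_shear C_class_Suc_GDERIV[OF assms])

lemma continuous_on_shear_fixed:
  assumes "continuous_on UNIV f"
  shows "continuous_on UNIV (\<lambda>x. f (shear \<alpha> s x))"
  unfolding shear_def
  by (rule continuous_on_compose2[OF assms]) (auto intro!: continuous_intros)

lemma C_class_shear: "C_class k f \<Longrightarrow> C_class k (\<lambda>x. f (shear \<alpha> s x))"
proof (induction k arbitrary: f)
  case (Suc k)
  have "C_class k (\<lambda>x. dir_deriv \<alpha> f (shear \<alpha> s x))"
    "C_class k (\<lambda>x. partial_deriv i f (shear \<alpha> s x))" for i
    using Suc C_class_dir_deriv C_class_partial_deriv by blast+
  then show ?case
    by (intro C_class_SucI[OF GDERIV_shear[OF Suc.prems]])
      (auto intro!: C_class_diff C_class_mult C_class_const)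
qed (simp add: continuous_on_shear_fixed)

lemma dir_deriv_shear:
  assumes "C_class (Suc k) f"
  shows "dir_deriv a (\<lambda>x. f (shear \<alpha> s x)) x
    = dir_deriv a f (shear \<alpha> s x) - s * (a \<bullet> \<alpha>) * dir_deriv \<alpha> f (shear \<alpha> s x)"
  using GDERIV_imp_grad[OF GDERIV_shear[OF assms]]
  by (simp add: dir_deriv_def inner_diff_right)

lemma dir_deriv_eq_sum_dir_deriv_axis:
  "dir_deriv a f x = (\<Sum>i\<in>UNIV. a $ i * dir_deriv (axis i 1) f x)"
  unfolding dir_deriv_axis by (simp add: dir_deriv_def inner_vec_def)

text \<open>The Laplacian is invariant under isometries. Concretely, the cross terms sum to -2
  D_\<alpha> D_\<alpha> f and the quadratic terms to |\<alpha>|^2 D_\<alpha> D_\<alpha> f, which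
  cancel since |\<alpha>|^2 = 2.\<close>

lemma laplacian_reflection:
  assumes a: "\<alpha> \<bullet> \<alpha> = 2" and f: "C_class (Suc (Suc k)) f"
  shows "laplacian (\<lambda>x. f (shear \<alpha> 1 x)) x = laplacian f (shear \<alpha> 1 x)"
proof -
  let ?y = "shear \<alpha> 1 x"
  have f1: "C_class (Suc k) f"
    using f C_class_SucD by blast
  have df: "C_class (Suc k) (dir_deriv a f)" for a
    using f C_class_dir_deriv by blast
  have dir: "dir_deriv a (\<lambda>x. f (shear \<alpha> 1 x))
      = (\<lambda>x. dir_deriv a f (shear \<alpha> 1 x) + - (a \<bullet> \<alpha>) * dir_deriv \<alpha> f (shear \<alpha> 1 x))" for a
    by (rule ext) (simp add: dir_deriv_shear[OF f1])
  have dir2: "dir_deriv (axis i 1) (dir_deriv (axis i 1) (\<lambda>x. f (shear \<alpha> 1 x))) x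
      = dir_deriv (axis i 1) (dir_deriv (axis i 1) f) ?y
        - 2 * (\<alpha> $ i * dir_deriv (axis i 1) (dir_deriv \<alpha> f) ?y)
        + (\<alpha> $ i * \<alpha> $ i) * dir_deriv \<alpha> (dir_deriv \<alpha> f) ?y" for i
    unfolding dir dir_deriv_add[OF C_class_shear[OF df] C_class_cmult[OF C_class_shear[OF df]]]
      dir_deriv_cmult[OF C_class_shear[OF df]] dir_deriv_shear[OF df]
    by (simp add: dir_deriv_commute[OF f, of \<alpha> "axis i 1"] inner_axis' algebra_simps)
  have "(\<Sum>i\<in>UNIV. \<alpha> $ i * \<alpha> $ i) = 2"
    using a by (simp add: inner_vec_def)
  then show ?thesis
    unfolding laplacian_eq dir2
    by (simp add: sum.distrib sum_subtractf dir_deriv_eq_sum_dir_deriv_axis[of \<alpha> "dir_deriv \<alpha> f"]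
        flip: sum_distrib_left sum_distrib_right)
qed

section \<open>The Dunkl Laplacian and its square field\<close>

text \<open>A finite union of hyperplanes is negligible, hence has empty interior. With continuity,
  this carries facts proved by division by <\<alpha>, x> over to all of space.\<close>

lemma closure_regular_points:
  fixes P :: "(real^'n::finite) set"
  assumes "finite P" and "0 \<notin> P"
  shows "closure {x. \<forall>\<alpha>\<in>P. \<alpha> \<bullet> x \<noteq> 0} = UNIV"
proof -
  let ?N = "\<Union>\<alpha>\<in>P. {x. \<alpha> \<bullet> x = 0}"
  have "negligible ?N"
    using assms by (intro negligible_Union) (auto intro!: negligible_hyperplane)
  then have "interior ?N = {}"
    using negligible_subset[OF _ interior_subset] open_interior open_not_negligible by metis
  moreover have "{x. \<forall>\<alpha>\<in>P. \<alpha> \<bullet> x \<noteq> 0} = - ?N"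
    by auto
  ultimately show ?thesis
    by (simp only: closure_complement) simp
qed

lemma refl_quotient_eq:
  assumes "C_class (Suc k) f" and "\<alpha> \<bullet> x \<noteq> 0"
  shows "refl_quotient \<alpha> f x = (f x - f (shear \<alpha> 1 x)) / (\<alpha> \<bullet> x)"
  using inner_mult_refl_quotient[OF assms(1), of \<alpha> x] assms(2) by (simp add: field_simps)

lemma dunkl_part_eq:
  assumes "C_class (Suc (Suc k)) f" and "\<alpha> \<bullet> x \<noteq> 0"
  shows "dunkl_part \<alpha> f x = (dir_deriv \<alpha> f x - refl_quotient \<alpha> f x) / (\<alpha> \<bullet> x)"
  using inner_mult_dunkl_part[OF assms(1), of \<alpha> x] assms(2) by (simp add: field_simps)

text \<open>Off the hyperplane the two formulas agree. On it, the limit that defines the left side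
  is the value of the right side, which is continuous.\<close>

lemma dunkl_term_eq_dunkl_part:
  fixes f :: "real^'n::finite \<Rightarrow> real"
  assumes \<alpha>: "\<alpha> \<bullet> \<alpha> = 2" and f: "C_class (Suc (Suc k)) f"
  shows "dunkl_term \<alpha> f = dunkl_part \<alpha> f"
proof
  fix x
  define h where "h z = (\<alpha> \<bullet> grad f z) / (\<alpha> \<bullet> z) - (f z - f (root_reflection \<alpha> z)) / (\<alpha> \<bullet> z)\<^sup>2" for z
  let ?S = "{z. \<alpha> \<bullet> z \<noteq> 0}"
  have f1: "C_class (Suc k) f"
    using f by (rule C_class_SucD)
  have h: "dunkl_part \<alpha> f z = h z" if "z \<in> ?S" for z
    using that dunkl_part_eq[OF f] refl_quotient_eq[OF f1]
    by (simp add: h_def root_reflection_eq_shear[OF \<alpha>] dir_deriv_def diff_divide_distrib power2_eq_square)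
  have ext: "dunkl_term \<alpha> f x = continuous_extension ?S h x"
    by (simp add: dunkl_term_def h_def[abs_def])
  show "dunkl_term \<alpha> f x = dunkl_part \<alpha> f x"
  proof (cases "x \<in> ?S")
    case True
    then show ?thesis
      using h[OF True] by (simp add: ext continuous_extension_def)
  next
    case False
    have "\<alpha> \<noteq> 0"
      using \<alpha> by auto
    then have "closure ?S = UNIV"
      using closure_regular_points[of "{\<alpha>}"] by simp
    then have "x islimpt ?S"
      using False unfolding closure_def by blast
    \<comment> \<open>\<open>Lim\<close> is determined by convergence only along a nontrivial
      filter, so x has to be a limit point of the regular set.\<close>
    then have "at x within ?S \<noteq> bot"
      by (simp add: trivial_limit_within)
    moreover have "(dunkl_part \<alpha> f \<longlongrightarrow> dunkl_part \<alpha> f x) (at x within ?S)"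
      using C_class_continuous[OF C_class_dunkl_part[OF f], of \<alpha>]
        continuous_on_subset[of UNIV "dunkl_part \<alpha> f" "insert x ?S"]
      unfolding continuous_on_def by (meson UNIV_I insertI1 subset_UNIV tendsto_within_subset)
    then have "(h \<longlongrightarrow> dunkl_part \<alpha> f x) (at x within ?S)"
      by (rule Lim_transform_eventually) (use h in \<open>auto simp: eventually_at_filter\<close>)
    ultimately have "Lim (at x within ?S) h = dunkl_part \<alpha> f x"
      by (rule tendsto_Lim)
    then show ?thesis
      using False by (simp add: ext continuous_extension_def)
  qed
qed

lemma dunkl_laplacian_eq:
  assumes "\<And>\<alpha>. \<alpha> \<in> P \<Longrightarrow> \<alpha> \<bullet> \<alpha> = 2" and "C_class (Suc (Suc k)) f"
  shows "dunkl_laplacian P \<kappa> f = (\<lambda>x. laplacian f x + 2 * (\<Sum>\<alpha>\<in>P. \<kappa> \<alpha> * dunkl_part \<alpha> f x))"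
  using dunkl_term_eq_dunkl_part[OF assms(1) assms(2)]
  by (intro ext) (simp add: dunkl_laplacian_def)

lemma C_class_dunkl_laplacian:
  assumes "\<And>\<alpha>. \<alpha> \<in> P \<Longrightarrow> \<alpha> \<bullet> \<alpha> = 2" and "C_class (Suc (Suc k)) f"
  shows "C_class k (dunkl_laplacian P \<kappa> f)"
  by (subst dunkl_laplacian_eq[OF assms])
    (auto intro!: C_class_add C_class_cmult C_class_sum C_class_laplacian C_class_dunkl_part assms(2))

text \<open>Two derivatives are counted as lost because the definition passes through
  \<open>dunkl_laplacian\<close>. The explicit formula would cost only one, but its extension across
  the hyperplanes relies on this lemma.\<close>

lemma C_class_carre_du_champ:
  assumes P: "\<And>\<alpha>. \<alpha> \<in> P \<Longrightarrow> \<alpha> \<bullet> \<alpha> = 2"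
    and f: "C_class (Suc (Suc k)) f" and g: "C_class (Suc (Suc k)) g"
  shows "C_class k (carre_du_champ P \<kappa> f g)"
proof -
  have "C_class k f" "C_class k g"
    using f g C_class_SucD by blast+
  then have "C_class k (\<lambda>x. 1 / 2 * (dunkl_laplacian P \<kappa> (\<lambda>z. f z * g z) x
       - f x * dunkl_laplacian P \<kappa> g x - g x * dunkl_laplacian P \<kappa> f x))"
    by (intro C_class_cmult C_class_diff C_class_mult C_class_dunkl_laplacian P f g)
  then show ?thesis
    by (simp add: carre_du_champ_def[abs_def])
qed

text \<open>With f', g' for the reflected functions, f g - f' g' = f (g - g') + g (f - f') - (f -
  f') (g - g'). The last product is the defect from the Leibniz rule and becomes the product of the
  two quotients.\<close>

lemma dunkl_part_mult:
  assumes f: "C_class (Suc (Suc k)) f" and g: "C_class (Suc (Suc k)) g" and x: "\<alpha> \<bullet> x \<noteq> 0"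
  shows "dunkl_part \<alpha> (\<lambda>z. f z * g z) x
    = f x * dunkl_part \<alpha> g x + g x * dunkl_part \<alpha> f x + refl_quotient \<alpha> f x * refl_quotient \<alpha> g x"
proof -
  have f1: "C_class (Suc k) f" and g1: "C_class (Suc k) g"
    using f g C_class_SucD by blast+
  show ?thesis
    using x
    by (simp add: dunkl_part_eq[OF f] dunkl_part_eq[OF g] dunkl_part_eq[OF C_class_mult[OF f g]]
        refl_quotient_eq[OF f1] refl_quotient_eq[OF g1] refl_quotient_eq[OF C_class_mult[OF f1 g1]]
        dir_deriv_mult[OF f1 g1] field_simps)
qed

text \<open>The product rules give the formula at regular points; both sides are continuous, so it
  holds everywhere. It is needed at every point because \<open>Gamma2\<close> differentiates the
  square field once more.\<close>

lemma carre_du_champ_eq: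
  assumes fin: "finite P" and P: "\<And>\<alpha>. \<alpha> \<in> P \<Longrightarrow> \<alpha> \<bullet> \<alpha> = 2"
    and f: "C_class (Suc (Suc k)) f" and g: "C_class (Suc (Suc k)) g"
  shows "carre_du_champ P \<kappa> f g x
    = grad f x \<bullet> grad g x + (\<Sum>\<alpha>\<in>P. \<kappa> \<alpha> * (refl_quotient \<alpha> f x * refl_quotient \<alpha> g x))"
proof -
  have f1: "C_class (Suc k) f" and g1: "C_class (Suc k) g"
    using f g C_class_SucD by blast+
  let ?S = "{x. \<forall>\<alpha>\<in>P. \<alpha> \<bullet> x \<noteq> 0}"
  define F where "F x = carre_du_champ P \<kappa> f g x - (grad f x \<bullet> grad g x
      + (\<Sum>\<alpha>\<in>P. \<kappa> \<alpha> * (refl_quotient \<alpha> f x * refl_quotient \<alpha> g x)))" for x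
  have "F z = 0" if z: "z \<in> ?S" for z
  proof -
    have "(\<Sum>\<alpha>\<in>P. \<kappa> \<alpha> * dunkl_part \<alpha> (\<lambda>z. f z * g z) z)
      = f z * (\<Sum>\<alpha>\<in>P. \<kappa> \<alpha> * dunkl_part \<alpha> g z) + g z * (\<Sum>\<alpha>\<in>P. \<kappa> \<alpha> * dunkl_part \<alpha> f z)
        + (\<Sum>\<alpha>\<in>P. \<kappa> \<alpha> * (refl_quotient \<alpha> f z * refl_quotient \<alpha> g z))"
      unfolding sum_distrib_left sum.distrib[symmetric]
      using z by (intro sum.cong) (simp_all add: dunkl_part_mult[OF f g] algebra_simps)
    then show ?thesis
      by (simp add: F_def carre_du_champ_def dunkl_laplacian_eq[OF P f] dunkl_laplacian_eq[OF P g]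
          dunkl_laplacian_eq[OF P C_class_mult[OF f g]] laplacian_mult[OF f g] algebra_simps)
  qed
  moreover have "C_class k F"
    unfolding F_def[abs_def]
    by (intro C_class_diff C_class_carre_du_champ P f g C_class_add C_class_inner_grad[OF f1 g1]
        C_class_sum C_class_cmult C_class_mult C_class_refl_quotient f1 g1)
  then have "continuous_on (closure ?S) F"
    using C_class_continuous continuous_on_subset by blast
  moreover have "x \<in> closure ?S"
    using closure_regular_points[OF fin] P by force
  ultimately have "F x = 0"
    using continuous_constant_on_closure[of ?S F 0 x] by blast
  then show ?thesis
    by (simp add: F_def)
qed

section \<open>From an abelian Weyl group to orthogonal roots\<close>

text \<open>Evaluating both compositions at the point \<alpha> gives c^2 \<alpha> = 2 c \<beta> with
  c = <\<alpha>, \<beta>>; if c were nonzero, \<beta> would be a multiple of \<alpha>.\<close>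

lemma orthogonal_if_reflections_commute:
  fixes \<alpha> \<beta> :: "real^'n::finite"
  assumes \<alpha>: "\<alpha> \<bullet> \<alpha> = 2" and \<beta>: "\<beta> \<bullet> \<beta> = 2"
    and comm: "\<And>x. shear \<alpha> 1 (shear \<beta> 1 x) = shear \<beta> 1 (shear \<alpha> 1 x)"
    and "\<beta> \<notin> range (\<lambda>c. c *\<^sub>R \<alpha>)"
  shows "\<alpha> \<bullet> \<beta> = 0"
proof (rule ccontr)
  let ?c = "\<alpha> \<bullet> \<beta>"
  assume c: "?c \<noteq> 0"
  have "?c * ?c * \<alpha> $ i = 2 * ?c * \<beta> $ i" for i
    using arg_cong[OF comm[of \<alpha>], of "\<lambda>v. v $ i"] \<alpha>
    by (simp add: shear_def inner_diff_right inner_commute algebra_simps)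
  then have "\<beta> = (?c / 2) *\<^sub>R \<alpha>"
    using c by (simp add: vec_eq_iff)
  then show False
    using assms(4) by blast
qed

text \<open>The isomorphism enters through commutativity: a product of cyclic groups is abelian, and
  this passes to the Weyl group, which contains the reflections as generators.\<close>

lemma weyl_group_comm_reflections:
  fixes R :: "(real^'n::finite) set"
  assumes R: "normalized_root_system R"
    and iso: "weyl_group R \<cong> product_group {..<CARD('n)} (\<lambda>_. integer_mod_group 2)"
    and "\<alpha> \<in> R" and "\<beta> \<in> R"
  shows "root_reflection \<alpha> (root_reflection \<beta> x) = root_reflection \<beta> (root_reflection \<alpha> x)"
proof -
  have sq: "\<gamma> \<bullet> \<gamma> = 2" if "\<gamma> \<in> R" for \<gamma>
    using R that by (simp add: normalized_root_system_def dot_square_norm)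
  have bij: "root_reflection \<gamma> \<in> Bij UNIV" if "\<gamma> \<in> R" for \<gamma>
    using involuntory_imp_bij[of "root_reflection \<gamma>"] shear_shear_self[OF sq[OF that]]
    by (simp add: Bij_def root_reflection_eq_shear[OF sq[OF that]])
  have "group (BijGroup (UNIV :: (real^'n) set))"
    by (rule group_BijGroup)
  then have grp: "group (weyl_group R)"
    unfolding weyl_group_def by (simp add: group.group_subgroup_generated)
  have mem: "root_reflection \<gamma> \<in> carrier (weyl_group R)" if "\<gamma> \<in> R" for \<gamma>
    unfolding weyl_group_def carrier_subgroup_generated using that bij[OF that]
    by (auto intro!: generate.incl simp: BijGroup_def)
  have "comm_group (product_group {..<CARD('n)} (\<lambda>_. integer_mod_group 2))"
    by (rule group.group_comm_groupI) (auto simp: add.commute PiE_def Pi_def intro!: restrict_ext)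
  moreover have "product_group {..<CARD('n)} (\<lambda>_. integer_mod_group 2) \<cong> weyl_group R"
    using iso grp by (rule group.iso_sym[rotated])
  moreover have "monoid (weyl_group R)"
    using grp by (rule group.is_monoid)
  ultimately have "comm_group (weyl_group R)"
    by (rule comm_group.iso_imp_comm_group)
  then have "root_reflection \<alpha> \<otimes>\<^bsub>weyl_group R\<^esub> root_reflection \<beta>
    = root_reflection \<beta> \<otimes>\<^bsub>weyl_group R\<^esub> root_reflection \<alpha>"
    by (rule comm_groupE(4)[OF _ mem[OF assms(3)] mem[OF assms(4)]])
  \<comment> \<open>Multiplication in \<open>BijGroup\<close> is composition restricted to
    bijections, so bijectivity of both reflections is used to unfold it.\<close>
  then have "compose UNIV (root_reflection \<alpha>) (root_reflection \<beta>)
    = compose UNIV (root_reflection \<beta>) (root_reflection \<alpha>)"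
    using bij[OF assms(3)] bij[OF assms(4)] by (simp add: weyl_group_def subgroup_generated_def BijGroup_def)
  then show ?thesis
    by (simp add: compose_def fun_eq_iff)
qed

text \<open>The line through \<alpha> meets R in \<alpha> and -\<alpha>, and these are not both
  positive; so two distinct positive roots are not proportional.\<close>

lemma positive_roots_orthogonal:
  fixes R :: "(real^'n::finite) set"
  assumes R: "normalized_root_system R"
    and iso: "weyl_group R \<cong> product_group {..<CARD('n)} (\<lambda>_. integer_mod_group 2)"
    and \<alpha>: "\<alpha> \<in> positive_roots R y" and \<beta>: "\<beta> \<in> positive_roots R y" and "\<alpha> \<noteq> \<beta>"
  shows "\<alpha> \<bullet> \<beta> = 0"
proof -
  have mem: "\<alpha> \<in> R" "\<beta> \<in> R"
    using \<alpha> \<beta> by (simp_all add: positive_roots_def)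
  have sq: "\<gamma> \<bullet> \<gamma> = 2" if "\<gamma> \<in> R" for \<gamma>
    using R that by (simp add: normalized_root_system_def dot_square_norm)
  have "\<beta> \<noteq> - \<alpha>"
    using \<alpha> \<beta> by (auto simp: positive_roots_def)
  moreover have "R \<inter> range (\<lambda>c. c *\<^sub>R \<alpha>) = {\<alpha>, - \<alpha>}"
    using R mem by (simp add: normalized_root_system_def root_system_def)
  ultimately have "\<beta> \<notin> range (\<lambda>c. c *\<^sub>R \<alpha>)"
    using mem(2) \<open>\<alpha> \<noteq> \<beta>\<close> by (metis IntI insertE singletonD)
  then show ?thesis
    using weyl_group_comm_reflections[OF R iso mem]
    by (intro orthogonal_if_reflections_commute sq mem)
      (auto simp: root_reflection_eq_shear sq mem)
qed

section \<open>The commutation identities\<close>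

text \<open>Schwarz's theorem twice: once under the outer derivative, then for the first derivative
  of f along an axis. The second use is what asks for three derivatives of f.\<close>

lemma laplacian_dir_deriv:
  assumes f: "C_class (Suc (Suc (Suc k))) f"
  shows "laplacian (dir_deriv a f) x = dir_deriv a (laplacian f) x"
proof -
  have f2: "C_class (Suc (Suc k)) f"
    using f by (rule C_class_SucD)
  have df: "C_class (Suc (Suc k)) (dir_deriv b f)" for b
    using f by (rule C_class_dir_deriv)
  have ddf: "C_class (Suc k) (dir_deriv b (dir_deriv b f))" for b
    using df by (rule C_class_dir_deriv)
  have comm: "dir_deriv b (dir_deriv a f) = dir_deriv a (dir_deriv b f)" for b
    by (rule ext) (rule dir_deriv_commute[OF f2])
  have "laplacian (dir_deriv a f) x
    = (\<Sum>i\<in>UNIV. dir_deriv a (dir_deriv (axis i 1) (dir_deriv (axis i 1) f)) x)"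
    unfolding laplacian_eq comm by (rule sum.cong[OF refl]) (rule dir_deriv_commute[OF df])
  also have "\<dots> = dir_deriv a (laplacian f) x"
    unfolding laplacian_eq[abs_def] by (rule dir_deriv_sum[symmetric]) (rule ddf)
  finally show ?thesis .
qed

lemma hs_norm_hessian:
  "(hs_norm (hessian f x))\<^sup>2 = (\<Sum>j\<in>UNIV. grad (partial_deriv j f) x \<bullet> grad (partial_deriv j f) x)"
proof -
  have "(hs_norm (hessian f x))\<^sup>2
    = (\<Sum>i\<in>UNIV. \<Sum>j\<in>UNIV. (partial_deriv i (partial_deriv j f) x)\<^sup>2)"
    by (simp add: hs_norm_def hessian_def sum_nonneg)
  also have "\<dots> = (\<Sum>j\<in>UNIV. \<Sum>i\<in>UNIV. (partial_deriv i (partial_deriv j f) x)\<^sup>2)"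
    by (rule sum.swap)
  finally show ?thesis
    by (simp add: inner_vec_def power2_eq_square)
qed

text \<open>The product rule for each square of a partial derivative: the cross terms add up to the
  Hessian norm, and the rest follows since the Laplacian commutes with partial derivatives.\<close>

lemma bochner:
  fixes f :: "real^'n::finite \<Rightarrow> real"
  assumes f: "C_class (Suc (Suc (Suc k))) f"
  shows "laplacian (\<lambda>z. grad f z \<bullet> grad f z) x
    = 2 * (hs_norm (hessian f x))\<^sup>2 + 2 * (grad f x \<bullet> grad (laplacian f) x)"
proof -
  have C: "C_class (Suc (Suc k)) (partial_deriv j f)" for j
    using f by (rule C_class_partial_deriv)
  have lap: "laplacian (partial_deriv j f) x = partial_deriv j (laplacian f) x" for j
    unfolding partial_deriv_eq_dir_deriv by (rule laplacian_dir_deriv[OF f])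
  have "laplacian (\<lambda>z. grad f z \<bullet> grad f z) x
    = (\<Sum>j\<in>UNIV. laplacian (\<lambda>z. partial_deriv j f z * partial_deriv j f z) x)"
    unfolding inner_vec_def grad_nth inner_real_def by (rule laplacian_sum[OF C_class_mult[OF C C]])
  also have "\<dots> = 2 * (\<Sum>j\<in>UNIV. grad (partial_deriv j f) x \<bullet> grad (partial_deriv j f) x)
      + 2 * (\<Sum>j\<in>UNIV. partial_deriv j f x * partial_deriv j (laplacian f) x)"
    unfolding laplacian_mult[OF C C] lap by (simp add: sum.distrib sum_distrib_left algebra_simps)
  finally show ?thesis
    by (simp add: hs_norm_hessian inner_vec_def[of "grad f x"])
qed

lemma dir_deriv_inner_grad:
  assumes f: "C_class (Suc (Suc k)) f"
  shows "dir_deriv a (\<lambda>z. grad f z \<bullet> grad f z) x = 2 * (grad f x \<bullet> grad (dir_deriv a f) x)"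
proof -
  have C: "C_class (Suc k) (partial_deriv j f)" for j
    using f by (rule C_class_partial_deriv)
  have comm: "dir_deriv a (partial_deriv j f) x = partial_deriv j (dir_deriv a f) x" for j
    unfolding partial_deriv_eq_dir_deriv by (rule dir_deriv_commute[OF f])
  have "dir_deriv a (\<lambda>z. grad f z \<bullet> grad f z) x
    = (\<Sum>j\<in>UNIV. dir_deriv a (\<lambda>z. partial_deriv j f z * partial_deriv j f z) x)"
    unfolding inner_vec_def grad_nth inner_real_def by (rule dir_deriv_sum[OF C_class_mult[OF C C]])
  also have "\<dots> = 2 * (\<Sum>j\<in>UNIV. partial_deriv j f x * partial_deriv j (dir_deriv a f) x)"
    unfolding dir_deriv_mult[OF C C] comm by (simp add: sum_distrib_left)
  finally show ?thesis
    by (simp add: inner_vec_def)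
qed

section \<open>Derivatives of the quotients and the terms of the iterated square field\<close>

text \<open>The gradient of \<open>inner_mult_refl_quotient\<close>, with no division. The sheared
  gradient on the right is that of f composed with the shear.\<close>

lemma grad_refl_quotient:
  assumes f: "C_class (Suc (Suc k)) f"
  shows "(\<alpha> \<bullet> x) *\<^sub>R grad (refl_quotient \<alpha> f) x + refl_quotient \<alpha> f x *\<^sub>R \<alpha>
    = grad f x - shear \<alpha> 1 (grad f (shear \<alpha> 1 x))"
proof -
  have f1: "C_class (Suc k) f"
    using f by (rule C_class_SucD)
  have \<delta>: "C_class (Suc k) (refl_quotient \<alpha> f)"
    using f by (rule C_class_refl_quotient)
  have "grad (\<lambda>z. (\<alpha> \<bullet> z) * refl_quotient \<alpha> f z) x = grad (\<lambda>z. f z - f (shear \<alpha> 1 z)) x"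
    by (simp add: inner_mult_refl_quotient[OF f1])
  then show ?thesis
    unfolding grad_mult[OF C_class_inner_left \<delta>] grad_diff[OF f1 C_class_shear[OF f1]]
      GDERIV_imp_grad[OF GDERIV_shear[OF f1]]
    by (simp add: grad_inner_left shear_def[of \<alpha> 1 "grad f _"] dir_deriv_def)
qed

lemma grad_dunkl_part:
  assumes f: "C_class (Suc (Suc (Suc k))) f"
  shows "(\<alpha> \<bullet> x) *\<^sub>R grad (dunkl_part \<alpha> f) x + dunkl_part \<alpha> f x *\<^sub>R \<alpha>
    = grad (dir_deriv \<alpha> f) x - grad (refl_quotient \<alpha> f) x"
proof -
  have T: "C_class (Suc k) (dunkl_part \<alpha> f)"
    using f by (rule C_class_dunkl_part)
  have \<delta>: "C_class (Suc (Suc k)) (refl_quotient \<alpha> f)"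
    using f by (rule C_class_refl_quotient)
  have df: "C_class (Suc (Suc k)) (dir_deriv \<alpha> f)"
    using f by (rule C_class_dir_deriv)
  have "grad (\<lambda>z. (\<alpha> \<bullet> z) * dunkl_part \<alpha> f z) x = grad (\<lambda>z. dir_deriv \<alpha> f z - refl_quotient \<alpha> f z) x"
    by (simp add: inner_mult_dunkl_part[OF f])
  then show ?thesis
    unfolding grad_mult[OF C_class_inner_left T] grad_diff[OF df \<delta>]
    by (simp add: grad_inner_left)
qed

text \<open>After the gradients of both quotients are eliminated, this is an identity between scalar
  products. The term with <\<alpha>, x> in the denominator cancels in \<open>Gamma2_eq\<close>
  against the one in \<open>laplacian_refl_quotient_sq\<close>.\<close>

lemma dunkl_part_inner_grad:
  assumes \<alpha>: "\<alpha> \<bullet> \<alpha> = 2" and f: "C_class (Suc (Suc (Suc k))) f" and x: "\<alpha> \<bullet> x \<noteq> 0"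
  shows "dunkl_part \<alpha> (\<lambda>z. grad f z \<bullet> grad f z) x - 2 * (grad f x \<bullet> grad (dunkl_part \<alpha> f) x)
    = grad (refl_quotient \<alpha> f) x \<bullet> grad (refl_quotient \<alpha> f) x
      + 2 * refl_quotient \<alpha> f x * dir_deriv \<alpha> (refl_quotient \<alpha> f) x / (\<alpha> \<bullet> x)
      + 2 * (dunkl_part \<alpha> f x)\<^sup>2"
proof -
  define t where "t = \<alpha> \<bullet> x"
  define d where "d = refl_quotient \<alpha> f x"
  define T where "T = dunkl_part \<alpha> f x"
  define E where "E = grad (refl_quotient \<alpha> f) x"
  define G where "G = grad f x"
  define H where "H = grad f (shear \<alpha> 1 x)"
  define M where "M = grad (dir_deriv \<alpha> f) x"
  define Z where "Z = grad (dunkl_part \<alpha> f) x"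
  have f2: "C_class (Suc (Suc k)) f"
    using f by (rule C_class_SucD)
  have t: "t \<noteq> 0"
    using x by (simp add: t_def)
  have C: "C_class (Suc (Suc k)) (\<lambda>z. grad f z \<bullet> grad f z)"
    using f by (rule C_class_inner_grad[OF f])
  have T_eq: "t * T = \<alpha> \<bullet> G - d"
    using inner_mult_dunkl_part[OF f2, of \<alpha> x] by (simp add: t_def T_def d_def G_def dir_deriv_def)
  have "shear \<alpha> 1 H = G - t *\<^sub>R E - d *\<^sub>R \<alpha>"
    using grad_refl_quotient[OF f2, of \<alpha> x] by (simp add: t_def E_def d_def G_def H_def algebra_simps)
  \<comment> \<open>Reflections preserve length, so |H| is computed from the reflected vector, which
    is known in terms of G, E and \<alpha>.\<close>
  then have H: "H \<bullet> H = (G - t *\<^sub>R E - d *\<^sub>R \<alpha>) \<bullet> (G - t *\<^sub>R E - d *\<^sub>R \<alpha>)"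
    using inner_shear_shear[OF \<alpha>, of H] by simp
  have "t *\<^sub>R Z = M - E - T *\<^sub>R \<alpha>"
    using grad_dunkl_part[OF f, of \<alpha> x] by (simp add: t_def T_def E_def Z_def M_def algebra_simps)
  then have "G \<bullet> (t *\<^sub>R Z) = G \<bullet> (M - E - T *\<^sub>R \<alpha>)"
    by simp
  then have Z: "t * (G \<bullet> Z) = G \<bullet> M - G \<bullet> E - T * (\<alpha> \<bullet> G)"
    by (simp add: inner_diff_right inner_commute)
  have lhs: "dunkl_part \<alpha> (\<lambda>z. grad f z \<bullet> grad f z) x = (2 * (G \<bullet> M) - (G \<bullet> G - H \<bullet> H) / t) / t"
    unfolding dunkl_part_eq[OF C x] refl_quotient_eq[OF C_class_SucD[OF C] x] dir_deriv_inner_grad[OF f2]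
    by (simp add: t_def M_def G_def H_def)
  have "(2 * (G \<bullet> M) - (G \<bullet> G - H \<bullet> H) / t) / t - 2 * (G \<bullet> Z)
    = E \<bullet> E + 2 * d * (\<alpha> \<bullet> E) / t + 2 * T\<^sup>2"
  proof -
    have p: "\<alpha> \<bullet> G = t * T + d"
      using T_eq by simp
    have HH: "H \<bullet> H = G \<bullet> G + t\<^sup>2 * (E \<bullet> E) + 2 * d\<^sup>2 - 2 * t * (G \<bullet> E) - 2 * d * (\<alpha> \<bullet> G)
      + 2 * t * d * (\<alpha> \<bullet> E)"
      unfolding H using \<alpha>
      by (simp add: inner_diff_left inner_diff_right inner_commute power2_eq_square algebra_simps)
    \<comment> \<open>The claim multiplied by t^2, where the formulas for t <G, Z>, <H, H> and
      <\<alpha>, G> can be substituted.\<close>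
    have "(2 * (G \<bullet> M) - (G \<bullet> G - H \<bullet> H) / t) * t - 2 * t * (t * (G \<bullet> Z))
      = (E \<bullet> E + 2 * d * (\<alpha> \<bullet> E) / t + 2 * T\<^sup>2) * t\<^sup>2"
      unfolding Z HH p using t by (simp add: field_simps power2_eq_square)
    then show ?thesis
      using t by (simp add: field_simps power2_eq_square)
  qed
  then show ?thesis
    unfolding lhs by (simp add: G_def Z_def E_def d_def t_def T_def dir_deriv_def)
qed

text \<open>Write t = <\<alpha>, x> and d for \<open>refl_quotient \<alpha>\<close>. Since t is
  harmonic, the Laplacian of t d f = f - f o r_\<alpha> gives \<Delta> d f = d \<Delta> f - 2
  D_\<alpha>(d f) / t; the product rule for the square does the rest.\<close>

lemma laplacian_refl_quotient_sq:
  assumes \<alpha>: "\<alpha> \<bullet> \<alpha> = 2" and f: "C_class (Suc (Suc (Suc k))) f" and x: "\<alpha> \<bullet> x \<noteq> 0"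
  shows "laplacian (\<lambda>z. refl_quotient \<alpha> f z * refl_quotient \<alpha> f z) x
      - 2 * (refl_quotient \<alpha> f x * refl_quotient \<alpha> (laplacian f) x)
    = 2 * (grad (refl_quotient \<alpha> f) x \<bullet> grad (refl_quotient \<alpha> f) x)
      - 4 * refl_quotient \<alpha> f x * dir_deriv \<alpha> (refl_quotient \<alpha> f) x / (\<alpha> \<bullet> x)"
proof -
  let ?d = "refl_quotient \<alpha> f"
  have f2: "C_class (Suc (Suc k)) f"
    using f by (rule C_class_SucD)
  have \<delta>: "C_class (Suc (Suc k)) ?d"
    using f by (rule C_class_refl_quotient)
  have lf: "C_class (Suc k) (laplacian f)"
    using f by (rule C_class_laplacian)
  have "laplacian (\<lambda>z. (\<alpha> \<bullet> z) * ?d z) x = laplacian (\<lambda>z. f z - f (shear \<alpha> 1 z)) x"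
    by (simp add: inner_mult_refl_quotient[OF f2])
  then have "(\<alpha> \<bullet> x) * laplacian ?d x + 2 * dir_deriv \<alpha> ?d x
    = laplacian f x - laplacian f (shear \<alpha> 1 x)"
    unfolding laplacian_mult[OF C_class_inner_left \<delta>] laplacian_diff[OF f2 C_class_shear[OF f2]]
      laplacian_reflection[OF \<alpha> f2]
    by (simp add: laplacian_inner_left grad_inner_left dir_deriv_def)
  then have lap: "laplacian ?d x = refl_quotient \<alpha> (laplacian f) x - 2 * dir_deriv \<alpha> ?d x / (\<alpha> \<bullet> x)"
    using x unfolding inner_mult_refl_quotient[OF lf, symmetric] by (simp add: field_simps)
  show ?thesis
    unfolding laplacian_mult[OF \<delta> \<delta>] lap by (simp add: algebra_simps)
qed

lemma dir_deriv_refl_quotient: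
  assumes \<alpha>: "\<alpha> \<bullet> \<alpha> = 2" and f: "C_class (Suc (Suc k)) f" and x: "\<alpha> \<bullet> x \<noteq> 0"
  shows "dir_deriv \<beta> (refl_quotient \<alpha> f) x
    = (dir_deriv \<beta> f x - dir_deriv \<beta> f (shear \<alpha> 1 x)
      + (\<alpha> \<bullet> \<beta>) * (dir_deriv \<alpha> f (shear \<alpha> 1 x) - refl_quotient \<alpha> f x)) / (\<alpha> \<bullet> x)"
  using arg_cong[OF grad_refl_quotient[OF f, of \<alpha> x], of "inner \<beta>"] x
  by (simp add: dir_deriv_def shear_def[of \<alpha> 1 "grad f _"] inner_add_right inner_diff_right
      inner_commute field_simps)

text \<open>Numerator and denominator both change sign under the reflection.\<close>

lemma refl_quotient_reflection:
  assumes \<alpha>: "\<alpha> \<bullet> \<alpha> = 2" and f: "C_class (Suc k) f" and x: "\<alpha> \<bullet> x \<noteq> 0"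
  shows "refl_quotient \<alpha> f (shear \<alpha> 1 x) = refl_quotient \<alpha> f x"
  using x by (simp add: refl_quotient_eq[OF f] inner_shear_self[OF \<alpha>] shear_shear_self[OF \<alpha>] field_simps)

text \<open>Invariance of d = \<open>refl_quotient \<alpha> f\<close> under its own reflection
  removes the difference part of the left side; both sides then equal 2 d D_\<alpha> d / <\<alpha>,
  x>. This makes the diagonal terms vanish.\<close>

lemma dunkl_part_refl_quotient_sq_same:
  assumes \<alpha>: "\<alpha> \<bullet> \<alpha> = 2" and f: "C_class (Suc (Suc (Suc k))) f" and x: "\<alpha> \<bullet> x \<noteq> 0"
  shows "dunkl_part \<alpha> (\<lambda>z. refl_quotient \<alpha> f z * refl_quotient \<alpha> f z) x
    = 2 * (refl_quotient \<alpha> f x * refl_quotient \<alpha> (dunkl_part \<alpha> f) x)"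
proof -
  let ?d = "refl_quotient \<alpha> f"
  have f2: "C_class (Suc (Suc k)) f" and f1: "C_class (Suc k) f"
    using f C_class_SucD by blast+
  have \<delta>: "C_class (Suc (Suc k)) ?d" and \<delta>1: "C_class (Suc k) ?d"
    using f C_class_refl_quotient C_class_SucD by blast+
  have T: "C_class (Suc k) (dunkl_part \<alpha> f)"
    using f by (rule C_class_dunkl_part)
  have x': "\<alpha> \<bullet> shear \<alpha> 1 x \<noteq> 0"
    using x by (simp add: inner_shear_self[OF \<alpha>])
  have d': "?d (shear \<alpha> 1 x) = ?d x"
    by (rule refl_quotient_reflection[OF \<alpha> f1 x])
  have "refl_quotient \<alpha> (dunkl_part \<alpha> f) x = dir_deriv \<alpha> ?d x / (\<alpha> \<bullet> x)"
    unfolding refl_quotient_eq[OF T x] dunkl_part_eq[OF f2 x] dunkl_part_eq[OF f2 x'] d'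
      dir_deriv_refl_quotient[OF \<alpha> f2 x]
    using x by (simp add: inner_shear_self[OF \<alpha>] \<alpha> field_simps)
  moreover have "dunkl_part \<alpha> (\<lambda>z. ?d z * ?d z) x = 2 * (?d x * dir_deriv \<alpha> ?d x) / (\<alpha> \<bullet> x)"
    unfolding dunkl_part_eq[OF C_class_mult[OF \<delta> \<delta>] x] refl_quotient_eq[OF C_class_mult[OF \<delta>1 \<delta>1] x]
      dir_deriv_mult[OF \<delta>1 \<delta>1] d' by simp
  ultimately show ?thesis
    by simp
qed

text \<open>Reflection in \<alpha> preserves <\<beta>, x>, and the two reflections commute. Hence
  \<open>refl_quotient \<alpha>\<close> commutes with \<open>dunkl_part \<beta>\<close>, and what is
  left is the defect from the Leibniz rule for \<open>dunkl_part \<beta>\<close>, a square.\<close>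

lemma dunkl_part_refl_quotient_sq_orthogonal:
  assumes \<alpha>: "\<alpha> \<bullet> \<alpha> = 2" and \<beta>: "\<beta> \<bullet> \<beta> = 2" and orth: "\<alpha> \<bullet> \<beta> = 0"
    and f: "C_class (Suc (Suc (Suc k))) f" and x: "\<alpha> \<bullet> x \<noteq> 0" and y: "\<beta> \<bullet> x \<noteq> 0"
  shows "dunkl_part \<beta> (\<lambda>z. refl_quotient \<alpha> f z * refl_quotient \<alpha> f z) x
      - 2 * (refl_quotient \<alpha> f x * refl_quotient \<alpha> (dunkl_part \<beta> f) x)
    = (refl_quotient \<beta> (refl_quotient \<alpha> f) x)\<^sup>2"
proof -
  let ?d = "refl_quotient \<alpha> f"
  let ?a = "shear \<alpha> 1 x" and ?b = "shear \<beta> 1 x"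
  have f2: "C_class (Suc (Suc k)) f" and f1: "C_class (Suc k) f"
    using f C_class_SucD by blast+
  have \<delta>: "C_class (Suc (Suc k)) ?d" and \<delta>1: "C_class (Suc k) ?d"
    using f C_class_refl_quotient C_class_SucD by blast+
  have T: "C_class (Suc k) (dunkl_part \<beta> f)"
    using f by (rule C_class_dunkl_part)
  have ya: "\<beta> \<bullet> ?a = \<beta> \<bullet> x" and xb: "\<alpha> \<bullet> ?b = \<alpha> \<bullet> x"
    using orth by (simp_all add: inner_shear_orthogonal inner_commute)
  have y': "\<beta> \<bullet> ?a \<noteq> 0" and x': "\<alpha> \<bullet> ?b \<noteq> 0"
    using x y by (simp_all add: ya xb)
  have ab: "shear \<beta> 1 ?a = shear \<alpha> 1 ?b"
    by (simp add: shear_commute[OF orth])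
  \<comment> \<open>The commutation: the right side is \<open>dunkl_part \<beta>\<close> of
    \<open>refl_quotient \<alpha> f\<close>, written out as a quotient.\<close>
  have T_eq: "refl_quotient \<alpha> (dunkl_part \<beta> f) x
      = (dir_deriv \<beta> ?d x - refl_quotient \<beta> ?d x) / (\<beta> \<bullet> x)"
    unfolding refl_quotient_eq[OF T x] dunkl_part_eq[OF f2 y] dunkl_part_eq[OF f2 y'] ya
      refl_quotient_eq[OF f1 y] refl_quotient_eq[OF f1 y'] refl_quotient_eq[OF \<delta>1 y]
      refl_quotient_eq[OF f1 x] refl_quotient_eq[OF f1 x'] xb ab dir_deriv_refl_quotient[OF \<alpha> f2 x] orth
    using x y by (simp add: field_simps)
  have sq: "dunkl_part \<beta> (\<lambda>z. ?d z * ?d z) x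
      = (2 * ?d x * dir_deriv \<beta> ?d x - (?d x * ?d x - ?d ?b * ?d ?b) / (\<beta> \<bullet> x)) / (\<beta> \<bullet> x)"
    unfolding dunkl_part_eq[OF C_class_mult[OF \<delta> \<delta>] y] refl_quotient_eq[OF C_class_mult[OF \<delta>1 \<delta>1] y]
      dir_deriv_mult[OF \<delta>1 \<delta>1] by simp
  show ?thesis
    unfolding sq T_eq refl_quotient_eq[OF \<delta>1 y]
    using y by (simp add: field_simps power2_eq_square)
qed

section \<open>The iterated square field\<close>

lemma dunkl_part_add:
  assumes f: "C_class (Suc (Suc k)) f" and g: "C_class (Suc (Suc k)) g" and x: "\<alpha> \<bullet> x \<noteq> 0"
  shows "dunkl_part \<alpha> (\<lambda>z. f z + g z) x = dunkl_part \<alpha> f x + dunkl_part \<alpha> g x"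
proof -
  have f1: "C_class (Suc k) f" and g1: "C_class (Suc k) g"
    using f g C_class_SucD by blast+
  show ?thesis
    using x
    by (simp add: dunkl_part_eq[OF f] dunkl_part_eq[OF g] dunkl_part_eq[OF C_class_add[OF f g]]
        refl_quotient_eq[OF f1] refl_quotient_eq[OF g1] refl_quotient_eq[OF C_class_add[OF f1 g1]]
        dir_deriv_add[OF f1 g1] field_simps)
qed

lemma dunkl_part_cmult:
  assumes f: "C_class (Suc (Suc k)) f" and x: "\<alpha> \<bullet> x \<noteq> 0"
  shows "dunkl_part \<alpha> (\<lambda>z. c * f z) x = c * dunkl_part \<alpha> f x"
proof -
  have f1: "C_class (Suc k) f"
    using f by (rule C_class_SucD)
  show ?thesis
    using x
    by (simp add: dunkl_part_eq[OF f] dunkl_part_eq[OF C_class_cmult[OF f]]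
        refl_quotient_eq[OF f1] refl_quotient_eq[OF C_class_cmult[OF f1]]
        dir_deriv_cmult[OF f1] field_simps)
qed

lemma dunkl_part_const: "\<alpha> \<bullet> x \<noteq> 0 \<Longrightarrow> dunkl_part \<alpha> (\<lambda>z. c) x = 0"
  by (simp add: dunkl_part_eq[OF C_class_const] refl_quotient_eq[OF C_class_const[of "Suc 0"]]
      dir_deriv_def grad_const)

lemma dunkl_part_sum:
  assumes "\<And>i. i \<in> I \<Longrightarrow> C_class (Suc (Suc k)) (f i)" and x: "\<alpha> \<bullet> x \<noteq> 0"
  shows "dunkl_part \<alpha> (\<lambda>z. \<Sum>i\<in>I. f i z) x = (\<Sum>i\<in>I. dunkl_part \<alpha> (f i) x)"
  using assms(1)
proof (induction I rule: infinite_finite_induct)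
  case (insert i I)
  then show ?case
    using dunkl_part_add[of k "f i" "\<lambda>z. \<Sum>i\<in>I. f i z", OF _ _ x] C_class_sum[of I "Suc (Suc k)" f] by simp
qed (simp_all add: dunkl_part_const[OF x])

lemma refl_quotient_add:
  assumes f: "C_class (Suc k) f" and g: "C_class (Suc k) g" and x: "\<alpha> \<bullet> x \<noteq> 0"
  shows "refl_quotient \<alpha> (\<lambda>z. f z + g z) x = refl_quotient \<alpha> f x + refl_quotient \<alpha> g x"
  using x
  by (simp add: refl_quotient_eq[OF f] refl_quotient_eq[OF g] refl_quotient_eq[OF C_class_add[OF f g]] field_simps)

lemma refl_quotient_cmult:
  assumes f: "C_class (Suc k) f" and x: "\<alpha> \<bullet> x \<noteq> 0"
  shows "refl_quotient \<alpha> (\<lambda>z. c * f z) x = c * refl_quotient \<alpha> f x"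
  using x by (simp add: refl_quotient_eq[OF f] refl_quotient_eq[OF C_class_cmult[OF f]] field_simps)

lemma refl_quotient_sum:
  assumes "\<And>i. i \<in> I \<Longrightarrow> C_class (Suc k) (f i)" and x: "\<alpha> \<bullet> x \<noteq> 0"
  shows "refl_quotient \<alpha> (\<lambda>z. \<Sum>i\<in>I. f i z) x = (\<Sum>i\<in>I. refl_quotient \<alpha> (f i) x)"
proof -
  have "refl_quotient \<alpha> (\<lambda>z. \<Sum>i\<in>I. f i z) x
    = ((\<Sum>i\<in>I. f i x) - (\<Sum>i\<in>I. f i (shear \<alpha> 1 x))) / (\<alpha> \<bullet> x)"
    by (rule refl_quotient_eq[OF C_class_sum[OF assms(1)] x])
  also have "\<dots> = (\<Sum>i\<in>I. refl_quotient \<alpha> (f i) x)"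
    unfolding sum_subtractf[symmetric] sum_divide_distrib
    by (rule sum.cong) (simp_all add: refl_quotient_eq[OF assms(1) x])
  finally show ?thesis .
qed

text \<open>Both the Dunkl Laplacian and the square field are a classical part plus a part linear in
  \<kappa>, so \<open>Gamma2\<close> has terms of degree 0, 1 and 2 in \<kappa>, and each degree is
  treated by its own identities.\<close>

lemma Gamma2_eq:
  fixes P :: "(real^'n::finite) set"
  assumes fin: "finite P" and P: "\<And>\<alpha>. \<alpha> \<in> P \<Longrightarrow> \<alpha> \<bullet> \<alpha> = 2"
    and orth: "\<And>\<alpha> \<beta>. \<alpha> \<in> P \<Longrightarrow> \<beta> \<in> P \<Longrightarrow> \<alpha> \<noteq> \<beta> \<Longrightarrow> \<alpha> \<bullet> \<beta> = 0"
    and f: "C_class (Suc (Suc (Suc (Suc k)))) f"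
    and x: "\<And>\<alpha>. \<alpha> \<in> P \<Longrightarrow> \<alpha> \<bullet> x \<noteq> 0"
  shows "Gamma2 P \<kappa> f f x = (hs_norm (hessian f x))\<^sup>2
    + 2 * (\<Sum>\<alpha>\<in>P. \<kappa> \<alpha> * (grad (refl_quotient \<alpha> f) x \<bullet> grad (refl_quotient \<alpha> f) x + (dunkl_part \<alpha> f x)\<^sup>2))
    + (\<Sum>\<beta>\<in>P. \<Sum>\<alpha>\<in>P - {\<beta>}. \<kappa> \<alpha> * \<kappa> \<beta> * (refl_quotient \<beta> (refl_quotient \<alpha> f) x)\<^sup>2)"
proof -
  let ?d = "\<lambda>\<alpha>. refl_quotient \<alpha> f" and ?T = "\<lambda>\<alpha>. dunkl_part \<alpha> f"
  let ?L = "dunkl_laplacian P \<kappa> f" and ?u = "\<lambda>z. grad f z \<bullet> grad f z"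
  have f3: "C_class (Suc (Suc (Suc k))) f"
    using f by (rule C_class_SucD)
  then have f2: "C_class (Suc (Suc k)) f"
    by (rule C_class_SucD)
  have u: "C_class (Suc (Suc k)) ?u"
    by (rule C_class_inner_grad[OF f3 f3])
  have d: "C_class (Suc (Suc k)) (?d \<alpha>)" for \<alpha>
    by (rule C_class_refl_quotient[OF f3])
  have T: "C_class (Suc (Suc k)) (?T \<alpha>)" and T1: "C_class (Suc k) (?T \<alpha>)" for \<alpha>
    using C_class_dunkl_part[OF f] C_class_SucD by blast+
  have lf: "C_class (Suc (Suc k)) (laplacian f)" and lf1: "C_class (Suc k) (laplacian f)"
    using C_class_laplacian[OF f] C_class_SucD by blast+
  have L: "C_class (Suc (Suc k)) ?L"
    by (rule C_class_dunkl_laplacian[OF P f])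
  have L_eq: "?L = (\<lambda>z. laplacian f z + 2 * (\<Sum>\<beta>\<in>P. \<kappa> \<beta> * ?T \<beta> z))"
    by (rule dunkl_laplacian_eq[OF P f2])
  have \<Gamma>: "carre_du_champ P \<kappa> f f = (\<lambda>z. ?u z + (\<Sum>\<alpha>\<in>P. \<kappa> \<alpha> * (?d \<alpha> z * ?d \<alpha> z)))"
    by (rule ext) (rule carre_du_champ_eq[OF fin P f2 f2])
  have dd: "C_class (Suc (Suc k)) (\<lambda>z. \<kappa> \<alpha> * (?d \<alpha> z * ?d \<alpha> z))" for \<alpha>
    by (intro C_class_cmult C_class_mult d)
  have sT: "C_class (Suc k) (\<lambda>z. \<Sum>\<beta>\<in>P. \<kappa> \<beta> * ?T \<beta> z)"
    by (intro C_class_sum C_class_cmult T1)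
  have grad_L: "grad f x \<bullet> grad ?L x
    = grad f x \<bullet> grad (laplacian f) x + 2 * (\<Sum>\<beta>\<in>P. \<kappa> \<beta> * (grad f x \<bullet> grad (?T \<beta>) x))"
    unfolding L_eq grad_add[OF lf1 C_class_cmult[OF sT]] grad_cmult[OF sT] grad_sum[OF C_class_cmult[OF T1]]
      grad_cmult[OF T1]
    by (simp add: inner_add_right inner_sum_right)
  have d_L: "refl_quotient \<alpha> ?L x
    = refl_quotient \<alpha> (laplacian f) x + 2 * (\<Sum>\<beta>\<in>P. \<kappa> \<beta> * refl_quotient \<alpha> (?T \<beta>) x)"
    if "\<alpha> \<in> P" for \<alpha>
    unfolding L_eq refl_quotient_add[OF lf1 C_class_cmult[OF sT] x[OF that]] refl_quotient_cmult[OF sT x[OF that]]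
      refl_quotient_sum[OF C_class_cmult[OF T1] x[OF that]] refl_quotient_cmult[OF T1 x[OF that]] by simp
  have lap_\<Gamma>: "laplacian (carre_du_champ P \<kappa> f f) x
    = laplacian ?u x + (\<Sum>\<alpha>\<in>P. \<kappa> \<alpha> * laplacian (\<lambda>z. ?d \<alpha> z * ?d \<alpha> z) x)"
    unfolding \<Gamma> laplacian_add[OF u C_class_sum[OF dd]] laplacian_sum[OF dd]
      laplacian_cmult[OF C_class_mult[OF d d]] by simp
  have T_\<Gamma>: "dunkl_part \<beta> (carre_du_champ P \<kappa> f f) x
    = dunkl_part \<beta> ?u x + (\<Sum>\<alpha>\<in>P. \<kappa> \<alpha> * dunkl_part \<beta> (\<lambda>z. ?d \<alpha> z * ?d \<alpha> z) x)"
    if "\<beta> \<in> P" for \<beta>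
    unfolding \<Gamma> dunkl_part_add[OF u C_class_sum[OF dd] x[OF that]] dunkl_part_sum[OF dd x[OF that]]
      dunkl_part_cmult[OF C_class_mult[OF d d] x[OF that]] by simp
  \<comment> \<open>A pairs the Dunkl part of the Laplacian with the classical square field, B the
    classical Laplacian with the Dunkl part of the square field; both have degree 1 in \<kappa>. C
    collects degree 2.\<close>
  define A where "A \<beta> = dunkl_part \<beta> ?u x - 2 * (grad f x \<bullet> grad (?T \<beta>) x)" for \<beta>
  define B where "B \<alpha> = laplacian (\<lambda>z. ?d \<alpha> z * ?d \<alpha> z) x - 2 * (?d \<alpha> x * refl_quotient \<alpha> (laplacian f) x)" for \<alpha>
  define C where "C \<beta> \<alpha> = dunkl_part \<beta> (\<lambda>z. ?d \<alpha> z * ?d \<alpha> z) x - 2 * (?d \<alpha> x * refl_quotient \<alpha> (?T \<beta>) x)" for \<alpha> \<beta>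
  \<comment> \<open>By symmetry the two subtracted terms of \<open>Gamma2\<close> coincide.\<close>
  have comm: "carre_du_champ P \<kappa> ?L f x = carre_du_champ P \<kappa> f ?L x"
    by (simp add: carre_du_champ_def mult.commute)
  have L_\<Gamma>: "dunkl_laplacian P \<kappa> (carre_du_champ P \<kappa> f f) x
    = laplacian (carre_du_champ P \<kappa> f f) x
      + 2 * (\<Sum>\<beta>\<in>P. \<kappa> \<beta> * dunkl_part \<beta> (carre_du_champ P \<kappa> f f) x)"
    by (rule dunkl_laplacian_eq[OF P C_class_carre_du_champ[OF P f f], THEN fun_cong])
  have \<Gamma>_L: "carre_du_champ P \<kappa> f ?L x = grad f x \<bullet> grad ?L x
      + (\<Sum>\<alpha>\<in>P. \<kappa> \<alpha> * (?d \<alpha> x * refl_quotient \<alpha> ?L x))"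
    by (rule carre_du_champ_eq[OF fin P f2 L])
  have LG: "dunkl_laplacian P \<kappa> (carre_du_champ P \<kappa> f f) x
    = laplacian ?u x + (\<Sum>\<alpha>\<in>P. \<kappa> \<alpha> * laplacian (\<lambda>z. ?d \<alpha> z * ?d \<alpha> z) x)
      + 2 * (\<Sum>\<beta>\<in>P. \<kappa> \<beta> * dunkl_part \<beta> ?u x)
      + 2 * (\<Sum>\<beta>\<in>P. \<Sum>\<alpha>\<in>P. \<kappa> \<alpha> * \<kappa> \<beta> * dunkl_part \<beta> (\<lambda>z. ?d \<alpha> z * ?d \<alpha> z) x)"
    unfolding L_\<Gamma> lap_\<Gamma>
    by (simp add: T_\<Gamma> distrib_left sum.distrib sum_distrib_left mult_ac cong: sum.cong)
  have GL: "carre_du_champ P \<kappa> f ?L x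
    = grad f x \<bullet> grad (laplacian f) x + 2 * (\<Sum>\<beta>\<in>P. \<kappa> \<beta> * (grad f x \<bullet> grad (?T \<beta>) x))
      + (\<Sum>\<alpha>\<in>P. \<kappa> \<alpha> * (?d \<alpha> x * refl_quotient \<alpha> (laplacian f) x))
      + 2 * (\<Sum>\<beta>\<in>P. \<Sum>\<alpha>\<in>P. \<kappa> \<alpha> * \<kappa> \<beta> * (?d \<alpha> x * refl_quotient \<alpha> (?T \<beta>) x))"
    unfolding \<Gamma>_L grad_L
      sum.swap[of "\<lambda>\<beta> \<alpha>. \<kappa> \<alpha> * \<kappa> \<beta> * (?d \<alpha> x * refl_quotient \<alpha> (?T \<beta>) x)"]
    by (simp add: d_L distrib_left sum.distrib sum_distrib_left mult_ac cong: sum.cong)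
  have "2 * Gamma2 P \<kappa> f f x = (laplacian ?u x - 2 * (grad f x \<bullet> grad (laplacian f) x))
    + (\<Sum>\<alpha>\<in>P. \<kappa> \<alpha> * B \<alpha>) + 2 * (\<Sum>\<beta>\<in>P. \<kappa> \<beta> * A \<beta>)
    + 2 * (\<Sum>\<beta>\<in>P. \<Sum>\<alpha>\<in>P. \<kappa> \<alpha> * \<kappa> \<beta> * C \<beta> \<alpha>)"
    unfolding Gamma2_def comm LG GL A_def B_def C_def
    by (simp add: right_diff_distrib sum_subtractf sum_distrib_left sum_negf mult_ac)
  also have "laplacian ?u x - 2 * (grad f x \<bullet> grad (laplacian f) x) = 2 * (hs_norm (hessian f x))\<^sup>2"
    by (simp add: bochner[OF f3])
  \<comment> \<open>The singular terms of B and 2 A cancel, and each contributes twice the squared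
    gradient of the quotient.\<close>
  also have "2 * (hs_norm (hessian f x))\<^sup>2 + (\<Sum>\<alpha>\<in>P. \<kappa> \<alpha> * B \<alpha>) + 2 * (\<Sum>\<beta>\<in>P. \<kappa> \<beta> * A \<beta>)
    = 2 * (hs_norm (hessian f x))\<^sup>2
      + 4 * (\<Sum>\<alpha>\<in>P. \<kappa> \<alpha> * (grad (?d \<alpha>) x \<bullet> grad (?d \<alpha>) x + (?T \<alpha> x)\<^sup>2))"
    unfolding sum_distrib_left add.assoc sum.distrib[symmetric]
    by (intro arg_cong2[where f = "(+)"] sum.cong refl)
      (simp add: A_def B_def dunkl_part_inner_grad[OF P f3 x] laplacian_refl_quotient_sq[OF P f3 x]
        algebra_simps)
  also have "(\<Sum>\<beta>\<in>P. \<Sum>\<alpha>\<in>P. \<kappa> \<alpha> * \<kappa> \<beta> * C \<beta> \<alpha>)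
    = (\<Sum>\<beta>\<in>P. \<Sum>\<alpha>\<in>P - {\<beta>}. \<kappa> \<alpha> * \<kappa> \<beta> * (refl_quotient \<beta> (?d \<alpha>) x)\<^sup>2)"
  proof (rule sum.cong[OF refl])
    fix \<beta> assume \<beta>: "\<beta> \<in> P"
    have "C \<beta> \<beta> = 0"
      by (simp add: C_def dunkl_part_refl_quotient_sq_same[OF P f3 x] \<beta>)
    moreover have "C \<beta> \<alpha> = (refl_quotient \<beta> (?d \<alpha>) x)\<^sup>2" if "\<alpha> \<in> P - {\<beta>}" for \<alpha>
      unfolding C_def
      by (rule dunkl_part_refl_quotient_sq_orthogonal[OF P P orth f3 x x]) (use that \<beta> in auto)
    ultimately show "(\<Sum>\<alpha>\<in>P. \<kappa> \<alpha> * \<kappa> \<beta> * C \<beta> \<alpha>)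
      = (\<Sum>\<alpha>\<in>P - {\<beta>}. \<kappa> \<alpha> * \<kappa> \<beta> * (refl_quotient \<beta> (?d \<alpha>) x)\<^sup>2)"
      by (simp add: sum.remove[OF fin \<beta>])
  qed
  finally show ?thesis
    by simp
qed

text \<open>Each of the two nested operators costs two derivatives.\<close>

lemma C_class_Gamma2:
  assumes P: "\<And>\<alpha>. \<alpha> \<in> P \<Longrightarrow> \<alpha> \<bullet> \<alpha> = 2" and f: "C_class (Suc (Suc (Suc (Suc k)))) f"
  shows "C_class k (Gamma2 P \<kappa> f f)"
proof -
  have f2: "C_class (Suc (Suc k)) f"
    using f C_class_SucD by blast
  have "C_class k (\<lambda>x. 1 / 2 * (dunkl_laplacian P \<kappa> (carre_du_champ P \<kappa> f f) x
       - carre_du_champ P \<kappa> (dunkl_laplacian P \<kappa> f) f x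
       - carre_du_champ P \<kappa> f (dunkl_laplacian P \<kappa> f) x))"
    by (intro C_class_cmult C_class_diff C_class_carre_du_champ C_class_dunkl_laplacian P f f2)
  then show ?thesis
    by (simp add: Gamma2_def[abs_def])
qed

text \<open>At regular points the difference is a sum of squares with nonnegative weights; the
  inequality passes to the closure, which is the whole space, because both sides are
  continuous.\<close>

lemma hessian_le_Gamma2_orthogonal:
  fixes P :: "(real^'n::finite) set"
  assumes fin: "finite P" and P: "\<And>\<alpha>. \<alpha> \<in> P \<Longrightarrow> \<alpha> \<bullet> \<alpha> = 2"
    and orth: "\<And>\<alpha> \<beta>. \<alpha> \<in> P \<Longrightarrow> \<beta> \<in> P \<Longrightarrow> \<alpha> \<noteq> \<beta> \<Longrightarrow> \<alpha> \<bullet> \<beta> = 0"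
    and \<kappa>: "\<And>\<alpha>. \<alpha> \<in> P \<Longrightarrow> \<kappa> \<alpha> \<ge> 0"
    and f: "C_class (Suc (Suc (Suc (Suc k)))) f"
  shows "(hs_norm (hessian f x))\<^sup>2 \<le> Gamma2 P \<kappa> f f x"
proof -
  let ?S = "{x. \<forall>\<alpha>\<in>P. \<alpha> \<bullet> x \<noteq> 0}"
  define F where "F z = (hs_norm (hessian f z))\<^sup>2 - Gamma2 P \<kappa> f f z" for z
  have f3: "C_class (Suc (Suc (Suc k))) f"
    using f by (rule C_class_SucD)
  have pd: "C_class (Suc k) (partial_deriv j f)" for j
    using C_class_partial_deriv[OF f3] by (rule C_class_SucD)
  have "C_class k (\<lambda>z. (hs_norm (hessian f z))\<^sup>2)"
    unfolding hs_norm_hessian by (intro C_class_sum C_class_inner_grad pd)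
  then have "C_class k F"
    unfolding F_def[abs_def] by (intro C_class_diff C_class_Gamma2 P f)
  then have "continuous_on (closure ?S) F"
    using C_class_continuous continuous_on_subset by blast
  moreover have "x \<in> closure ?S"
    using closure_regular_points[OF fin] P by force
  moreover have "F z \<le> 0" if z: "z \<in> ?S" for z
  proof -
    have "0 \<le> (\<Sum>\<alpha>\<in>P. \<kappa> \<alpha> * (grad (refl_quotient \<alpha> f) z \<bullet> grad (refl_quotient \<alpha> f) z + (dunkl_part \<alpha> f z)\<^sup>2))"
      by (intro sum_nonneg mult_nonneg_nonneg add_nonneg_nonneg \<kappa>) auto
    moreover have "0 \<le> (\<Sum>\<beta>\<in>P. \<Sum>\<alpha>\<in>P - {\<beta>}. \<kappa> \<alpha> * \<kappa> \<beta> * (refl_quotient \<beta> (refl_quotient \<alpha> f) z)\<^sup>2)"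
      by (intro sum_nonneg mult_nonneg_nonneg \<kappa>) auto
    ultimately show ?thesis
      using Gamma2_eq[OF fin P orth f, of z \<kappa>] z by (simp add: F_def)
  qed
  ultimately have "F x \<le> 0"
    using continuous_le_on_closure[of ?S F x 0] by blast
  then show ?thesis
    by (simp add: F_def)
qed

theorem proposition3p2:
  fixes R :: "(real^'n::finite) set" and y :: "real^'n" and \<kappa> :: "real^'n \<Rightarrow> real"
    and f :: "real^'n \<Rightarrow> real"
  assumes "normalized_root_system R"
    and "\<forall>\<alpha>\<in>R. \<alpha> \<bullet> y \<noteq> 0"
    and "invariant_multiplicity R \<kappa>"
    and "weyl_group R \<cong> product_group {..<CARD('n)} (\<lambda>_. integer_mod_group 2)"
    and "C_class 4 f"
  shows "\<forall>x. Gamma2 (positive_roots R y) \<kappa> f f x \<ge> (hs_norm (hessian f x))\<^sup>2"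
proof (intro allI hessian_le_Gamma2_orthogonal)
  show "finite (positive_roots R y)"
    using assms(1) by (simp add: normalized_root_system_def root_system_def positive_roots_def)
  show "\<alpha> \<bullet> \<alpha> = 2" if "\<alpha> \<in> positive_roots R y" for \<alpha>
    using assms(1) that by (simp add: normalized_root_system_def positive_roots_def dot_square_norm)
  show "\<kappa> \<alpha> \<ge> 0" if "\<alpha> \<in> positive_roots R y" for \<alpha>
    using assms(3) that by (simp add: invariant_multiplicity_def positive_roots_def)
  \<comment> \<open>The case k = 0: four derivatives of f leave both sides merely continuous, which
    is all the density argument uses.\<close>
  show "C_class (Suc (Suc (Suc (Suc 0)))) f"
    using assms(5) by (simp add: eval_nat_numeral)
qed (rule positive_roots_orthogonal[OF assms(1,4)])

end
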